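(* Let $\mathcal{A}$ be a bicomplete, locally small abelian category, let $\tau:T\hookrightarrow1_{\mathcal{A}}$ be any preradical of $\mathcal{A}$, and let $\mathbb{T}_\tau:=\{M\in\mathcal{A}\mid \tau_M:T(M)\to M\text{ is an isomorphism}\}$. Then $\tau$ is idempotent if and only if $$\tau=\bigvee_{M\in\mathbb{T}_\tau}\alpha_{1_M}.$$
   Context: Bicomplete means complete and cocomplete; locally small means that the class of subobjects of each object is a set; Hom-classes are sets. A preradical of an abelian category $\mathcal{A}$ is a subobject of the identity functor $1_{\mathcal{A}}$ in the (possibly extended) abelian category $\mathrm{Fun}(\mathcal{A},\mathcal{A})$, i.e. the equivalence class of a monomorphic natural transformation $\tau:T\hookrightarrow 1_{\mathcal{A}}$, two such being equivalent if each factors through the other. $Pr(\mathcal{A})$ is the collection of preradicals, ordered by $\tau\leq\sigma$ iff $\tau$ factors through $\sigma$; under the stated hypotheses on $\mathcal{A}$ every collection of preradicals (not necessarily a set) has a join $\bigvee$ and a meet $\bigwedge$. For $\tau:T\hookrightarrow 1_{\mathcal{A}}$ and $\sigma:S\hookrightarrow 1_{\mathcal{A}}$, the product $\tau\cdot\sigma$ is the class of $\sigma\circ\tau S=\tau\circ T\sigma:TS\to 1_{\mathcal{A}}$ (where $(\tau S)_A=\tau_{S(A)}$, $(T\sigma)_A=T(\sigma_A)$); $\tau$ is idempotent if $\tau\cdot\tau=\tau$. Alpha preradicals: for objects $N,M$ of $\mathcal{A}$, $\mathbb{A}_M^N:\mathcal{A}\to\mathcal{A}$ is the functor with $\mathbb{A}_M^N(L)=N^{(\mathrm{Hom}_{\mathcal{A}}(M,L))}$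 (coproduct of copies of $N$ indexed by $\mathrm{Hom}_{\mathcal{A}}(M,L)$, with canonical inclusions $i_f$), and, for $\lambda:L\to L'$, $\mathbb{A}_M^N(\lambda)\circ i_f=i'_{\lambda\circ f}$. For a morphism $h:N\to M$, $\mathfrak{a}_h:\mathbb{A}_M^N\to1_{\mathcal{A}}$ is the natural transformation determined by $[\mathfrak{a}_h]_L\circ i_f=f\circ h$ for all $L$ and all $f\in\mathrm{Hom}_{\mathcal{A}}(M,L)$. The alpha preradical associated to $h$ is $\alpha_h:=\mathrm{Im}(\mathfrak{a}_h)$; here $1_M$ is the identity morphism of $M$. *)

theory Defs
  imports "HOL-Algebra.Group" "HOL-Library.FuncSet"
begin

unbundle cardinal_syntax

section \<open>Smallness\<close>

text \<open>
  Sizes are measured against a fixed uncountable strongly inaccessible cardinal: ``set'' means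
  ``of cardinality less than \<open>\<kappa>\<close>'', ``class'' means an arbitrary HOL set. This is the usual reading
  relative to a Grothendieck universe.
\<close>

definition inaccessible :: "'k rel \<Rightarrow> bool" where
  "inaccessible \<kappa> \<longleftrightarrow> Card_order \<kappa> \<and> natLeq <o \<kappa> \<and> regularCard \<kappa> \<and>
     (\<forall>X :: 'k set. |X| <o \<kappa> \<longrightarrow> |Pow X| <o \<kappa>)"

definition small :: "'k rel \<Rightarrow> 'a set \<Rightarrow> bool" where
  "small \<kappa> X \<longleftrightarrow> |X| <o \<kappa>"


section \<open>Categories, functors, natural transformations\<close>

record ('o, 'm) precategory =
  Obj :: "'o set"
  Arr :: "'m set"
  Dom :: "'m \<Rightarrow> 'o"
  Cod :: "'m \<Rightarrow> 'o"
  Idn :: "'o \<Rightarrow> 'm"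
  Comp :: "'m \<Rightarrow> 'm \<Rightarrow> 'm"  (infixr \<open>\<cdot>\<index>\<close> 75)

definition Hom :: "('o, 'm) precategory \<Rightarrow> 'o \<Rightarrow> 'o \<Rightarrow> 'm set" where
  "Hom C A B = {f \<in> Arr C. Dom C f = A \<and> Cod C f = B}"

locale category =
  fixes C :: "('o, 'm) precategory" (structure)
  assumes Dom_closed: "f \<in> Arr C \<Longrightarrow> Dom C f \<in> Obj C"
    and Cod_closed: "f \<in> Arr C \<Longrightarrow> Cod C f \<in> Obj C"
    and Idn_closed: "A \<in> Obj C \<Longrightarrow> Idn C A \<in> Hom C A A"
    and Comp_closed: "f \<in> Hom C A B \<Longrightarrow> g \<in> Hom C B D \<Longrightarrow> g \<cdot> f \<in> Hom C A D"
    and Comp_Idn: "f \<in> Hom C A B \<Longrightarrow> f \<cdot> Idn C A = f"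
    and Idn_Comp: "f \<in> Hom C A B \<Longrightarrow> Idn C B \<cdot> f = f"
    and Comp_assoc: "f \<in> Hom C A B \<Longrightarrow> g \<in> Hom C B D \<Longrightarrow> h \<in> Hom C D E \<Longrightarrow>
      (h \<cdot> g) \<cdot> f = h \<cdot> (g \<cdot> f)"

record ('o1, 'm1, 'o2, 'm2) ftor =
  Fo :: "'o1 \<Rightarrow> 'o2"
  Fa :: "'m1 \<Rightarrow> 'm2"

text \<open>
  Functors and natural transformations are extensional outside the objects and arrows, so that HOL
  equality is equality of functors and of transformations.
\<close>

definition is_functor ::
  "('o1, 'm1) precategory \<Rightarrow> ('o2, 'm2) precategory \<Rightarrow> ('o1, 'm1, 'o2, 'm2) ftor \<Rightarrow> bool" where
  "is_functor C D F \<longleftrightarrow>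
     Fo F \<in> Obj C \<rightarrow>\<^sub>E Obj D \<and> Fa F \<in> Arr C \<rightarrow>\<^sub>E Arr D \<and>
     (\<forall>f\<in>Arr C. Fa F f \<in> Hom D (Fo F (Dom C f)) (Fo F (Cod C f))) \<and>
     (\<forall>A\<in>Obj C. Fa F (Idn C A) = Idn D (Fo F A)) \<and>
     (\<forall>f\<in>Arr C. \<forall>g\<in>Arr C. Dom C g = Cod C f \<longrightarrow> Fa F (g \<cdot>\<^bsub>C\<^esub> f) = Fa F g \<cdot>\<^bsub>D\<^esub> Fa F f)"

definition id_ftor :: "('o, 'm) precategory \<Rightarrow> ('o, 'm, 'o, 'm) ftor" where
  "id_ftor C = \<lparr> Fo = restrict (\<lambda>A. A) (Obj C), Fa = restrict (\<lambda>f. f) (Arr C) \<rparr>"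

definition comp_ftor :: "('o1, 'm1) precategory \<Rightarrow> ('o2, 'm2, 'o3, 'm3) ftor \<Rightarrow>
    ('o1, 'm1, 'o2, 'm2) ftor \<Rightarrow> ('o1, 'm1, 'o3, 'm3) ftor" where
  "comp_ftor C G F =
     \<lparr> Fo = restrict (\<lambda>A. Fo G (Fo F A)) (Obj C), Fa = restrict (\<lambda>f. Fa G (Fa F f)) (Arr C) \<rparr>"

record ('o1, 'm1, 'o2, 'm2) ntrans =
  Src :: "('o1, 'm1, 'o2, 'm2) ftor"
  Trg :: "('o1, 'm1, 'o2, 'm2) ftor"
  Cmp :: "'o1 \<Rightarrow> 'm2"

definition is_ntrans ::
  "('o1, 'm1) precategory \<Rightarrow> ('o2, 'm2) precategory \<Rightarrow> ('o1, 'm1, 'o2, 'm2) ntrans \<Rightarrow> bool" where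
  "is_ntrans C D \<eta> \<longleftrightarrow>
     is_functor C D (Src \<eta>) \<and> is_functor C D (Trg \<eta>) \<and> Cmp \<eta> \<in> extensional (Obj C) \<and>
     (\<forall>A\<in>Obj C. Cmp \<eta> A \<in> Hom D (Fo (Src \<eta>) A) (Fo (Trg \<eta>) A)) \<and>
     (\<forall>f\<in>Arr C. Fa (Trg \<eta>) f \<cdot>\<^bsub>D\<^esub> Cmp \<eta> (Dom C f) = Cmp \<eta> (Cod C f) \<cdot>\<^bsub>D\<^esub> Fa (Src \<eta>) f)"

definition Fun :: "('o1, 'm1) precategory \<Rightarrow> ('o2, 'm2) precategory \<Rightarrow>
    (('o1, 'm1, 'o2, 'm2) ftor, ('o1, 'm1, 'o2, 'm2) ntrans) precategory" where
  "Fun C D =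
     \<lparr> Obj = {F. is_functor C D F},
       Arr = {\<eta>. is_ntrans C D \<eta>},
       Dom = Src,
       Cod = Trg,
       Idn = (\<lambda>F. \<lparr> Src = F, Trg = F, Cmp = restrict (\<lambda>A. Idn D (Fo F A)) (Obj C) \<rparr>),
       Comp = (\<lambda>\<theta> \<eta>. \<lparr> Src = Src \<eta>, Trg = Trg \<theta>,
                       Cmp = restrict (\<lambda>A. Cmp \<theta> A \<cdot>\<^bsub>D\<^esub> Cmp \<eta> A) (Obj C) \<rparr>) \<rparr>"


section \<open>Abelian categories\<close>

definition is_mono :: "('o, 'm) precategory \<Rightarrow> 'm \<Rightarrow> bool" where
  "is_mono C m \<longleftrightarrow> m \<in> Arr C \<and>
     (\<forall>g\<in>Arr C. \<forall>h\<in>Arr C. Cod C g = Dom C m \<and> Cod C h = Dom C m \<and> Dom C g = Dom C h \<and>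
        m \<cdot>\<^bsub>C\<^esub> g = m \<cdot>\<^bsub>C\<^esub> h \<longrightarrow> g = h)"

definition is_epi :: "('o, 'm) precategory \<Rightarrow> 'm \<Rightarrow> bool" where
  "is_epi C e \<longleftrightarrow> e \<in> Arr C \<and>
     (\<forall>g\<in>Arr C. \<forall>h\<in>Arr C. Dom C g = Cod C e \<and> Dom C h = Cod C e \<and> Cod C g = Cod C h \<and>
        g \<cdot>\<^bsub>C\<^esub> e = h \<cdot>\<^bsub>C\<^esub> e \<longrightarrow> g = h)"

definition is_iso :: "('o, 'm) precategory \<Rightarrow> 'm \<Rightarrow> bool" where
  "is_iso C f \<longleftrightarrow> f \<in> Arr C \<and>
     (\<exists>g\<in>Hom C (Cod C f) (Dom C f). g \<cdot>\<^bsub>C\<^esub> f = Idn C (Dom C f) \<and> f \<cdot>\<^bsub>C\<^esub> g = Idn C (Cod C f))"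

definition zero_object :: "('o, 'm) precategory \<Rightarrow> 'o \<Rightarrow> bool" where
  "zero_object C Z \<longleftrightarrow> Z \<in> Obj C \<and>
     (\<forall>A\<in>Obj C. (\<exists>!f. f \<in> Hom C A Z) \<and> (\<exists>!f. f \<in> Hom C Z A))"

definition zero_arrow :: "('o, 'm) precategory \<Rightarrow> 'm \<Rightarrow> bool" where
  "zero_arrow C f \<longleftrightarrow> f \<in> Arr C \<and>
     (\<exists>Z. zero_object C Z \<and> (\<exists>g\<in>Hom C (Dom C f) Z. \<exists>h\<in>Hom C Z (Cod C f). f = h \<cdot>\<^bsub>C\<^esub> g))"

definition is_kernel :: "('o, 'm) precategory \<Rightarrow> 'm \<Rightarrow> 'm \<Rightarrow> bool" where
  "is_kernel C k f \<longleftrightarrow> f \<in> Arr C \<and> k \<in> Arr C \<and> Cod C k = Dom C f \<and> zero_arrow C (f \<cdot>\<^bsub>C\<^esub> k) \<and>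
     (\<forall>g\<in>Arr C. Cod C g = Dom C f \<and> zero_arrow C (f \<cdot>\<^bsub>C\<^esub> g) \<longrightarrow>
        (\<exists>!u. u \<in> Hom C (Dom C g) (Dom C k) \<and> k \<cdot>\<^bsub>C\<^esub> u = g))"

definition is_cokernel :: "('o, 'm) precategory \<Rightarrow> 'm \<Rightarrow> 'm \<Rightarrow> bool" where
  "is_cokernel C c f \<longleftrightarrow> f \<in> Arr C \<and> c \<in> Arr C \<and> Dom C c = Cod C f \<and> zero_arrow C (c \<cdot>\<^bsub>C\<^esub> f) \<and>
     (\<forall>g\<in>Arr C. Dom C g = Cod C f \<and> zero_arrow C (g \<cdot>\<^bsub>C\<^esub> f) \<longrightarrow>
        (\<exists>!u. u \<in> Hom C (Cod C c) (Cod C g) \<and> u \<cdot>\<^bsub>C\<^esub> c = g))"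

definition is_image :: "('o, 'm) precategory \<Rightarrow> 'm \<Rightarrow> 'm \<Rightarrow> bool" where
  "is_image C m f \<longleftrightarrow> (\<exists>c. is_cokernel C c f \<and> is_kernel C m c)"

text \<open>The operation \<open>add\<close> is the addition of each hom-set; it is irrelevant on non-parallel arrows.\<close>

definition preadditive :: "('o, 'm) precategory \<Rightarrow> ('m \<Rightarrow> 'm \<Rightarrow> 'm) \<Rightarrow> bool" where
  "preadditive C add \<longleftrightarrow> category C \<and>
     (\<forall>A\<in>Obj C. \<forall>B\<in>Obj C.
        \<exists>z. comm_group \<lparr> carrier = Hom C A B, monoid.mult = add, one = z \<rparr>) \<and>
     (\<forall>A\<in>Obj C. \<forall>B\<in>Obj C. \<forall>D\<in>Obj C. \<forall>f\<in>Hom C A B. \<forall>f'\<in>Hom C A B. \<forall>g\<in>Hom C B D. \<forall>g'\<in>Hom C B D.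
        g \<cdot>\<^bsub>C\<^esub> add f f' = add (g \<cdot>\<^bsub>C\<^esub> f) (g \<cdot>\<^bsub>C\<^esub> f') \<and>
        add g g' \<cdot>\<^bsub>C\<^esub> f = add (g \<cdot>\<^bsub>C\<^esub> f) (g' \<cdot>\<^bsub>C\<^esub> f))"

definition has_biproduct ::
  "('o, 'm) precategory \<Rightarrow> ('m \<Rightarrow> 'm \<Rightarrow> 'm) \<Rightarrow> 'o \<Rightarrow> 'o \<Rightarrow> bool" where
  "has_biproduct C add A B \<longleftrightarrow>
     (\<exists>P\<in>Obj C. \<exists>i\<in>Hom C A P. \<exists>j\<in>Hom C B P. \<exists>p\<in>Hom C P A. \<exists>q\<in>Hom C P B.
        p \<cdot>\<^bsub>C\<^esub> i = Idn C A \<and> q \<cdot>\<^bsub>C\<^esub> j = Idn C B \<and>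
        add (i \<cdot>\<^bsub>C\<^esub> p) (j \<cdot>\<^bsub>C\<^esub> q) = Idn C P)"

definition abelian :: "('o, 'm) precategory \<Rightarrow> bool" where
  "abelian C \<longleftrightarrow>
     (\<exists>add. preadditive C add \<and> (\<forall>A\<in>Obj C. \<forall>B\<in>Obj C. has_biproduct C add A B)) \<and>
     (\<exists>Z. zero_object C Z) \<and>
     (\<forall>f\<in>Arr C. (\<exists>k. is_kernel C k f) \<and> (\<exists>c. is_cokernel C c f)) \<and>
     (\<forall>m. is_mono C m \<longrightarrow> (\<exists>f. is_kernel C m f)) \<and>
     (\<forall>e. is_epi C e \<longrightarrow> (\<exists>f. is_cokernel C e f))"


section \<open>Limits, colimits and size conditions\<close>

definition is_cone :: "('i, 'j) precategory \<Rightarrow> ('o, 'm) precategory \<Rightarrow> ('i, 'j, 'o, 'm) ftor \<Rightarrow>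
    'o \<Rightarrow> ('i \<Rightarrow> 'm) \<Rightarrow> bool" where
  "is_cone J C D A p \<longleftrightarrow> A \<in> Obj C \<and> (\<forall>i\<in>Obj J. p i \<in> Hom C A (Fo D i)) \<and>
     (\<forall>a\<in>Arr J. Fa D a \<cdot>\<^bsub>C\<^esub> p (Dom J a) = p (Cod J a))"

definition is_cocone :: "('i, 'j) precategory \<Rightarrow> ('o, 'm) precategory \<Rightarrow> ('i, 'j, 'o, 'm) ftor \<Rightarrow>
    'o \<Rightarrow> ('i \<Rightarrow> 'm) \<Rightarrow> bool" where
  "is_cocone J C D A p \<longleftrightarrow> A \<in> Obj C \<and> (\<forall>i\<in>Obj J. p i \<in> Hom C (Fo D i) A) \<and>
     (\<forall>a\<in>Arr J. p (Cod J a) \<cdot>\<^bsub>C\<^esub> Fa D a = p (Dom J a))"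

definition is_limit :: "('i, 'j) precategory \<Rightarrow> ('o, 'm) precategory \<Rightarrow> ('i, 'j, 'o, 'm) ftor \<Rightarrow>
    'o \<Rightarrow> ('i \<Rightarrow> 'm) \<Rightarrow> bool" where
  "is_limit J C D A p \<longleftrightarrow> is_cone J C D A p \<and>
     (\<forall>B q. is_cone J C D B q \<longrightarrow> (\<exists>!u. u \<in> Hom C B A \<and> (\<forall>i\<in>Obj J. p i \<cdot>\<^bsub>C\<^esub> u = q i)))"

definition is_colimit :: "('i, 'j) precategory \<Rightarrow> ('o, 'm) precategory \<Rightarrow> ('i, 'j, 'o, 'm) ftor \<Rightarrow>
    'o \<Rightarrow> ('i \<Rightarrow> 'm) \<Rightarrow> bool" where
  "is_colimit J C D A p \<longleftrightarrow> is_cocone J C D A p \<and>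
     (\<forall>B q. is_cocone J C D B q \<longrightarrow> (\<exists>!u. u \<in> Hom C A B \<and> (\<forall>i\<in>Obj J. u \<cdot>\<^bsub>C\<^esub> p i = q i)))"

text \<open>
  It suffices to quantify over small categories with objects and arrows in the type \<^typ>\<open>'k\<close>
  underlying \<open>\<kappa>\<close>: every small category is isomorphic to one of these.
\<close>

definition bicomplete :: "'k rel \<Rightarrow> ('o, 'm) precategory \<Rightarrow> bool" where
  "bicomplete \<kappa> C \<longleftrightarrow>
     (\<forall>(J :: ('k, 'k) precategory) D.
        category J \<and> small \<kappa> (Obj J) \<and> small \<kappa> (Arr J) \<and> is_functor J C D \<longrightarrow>
        (\<exists>A p. is_limit J C D A p) \<and> (\<exists>A p. is_colimit J C D A p))"

definition monos_into :: "('o, 'm) precategory \<Rightarrow> 'o \<Rightarrow> 'm set" where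
  "monos_into C A = {m. is_mono C m \<and> Cod C m = A}"

definition factors_through :: "('o, 'm) precategory \<Rightarrow> 'm \<Rightarrow> 'm \<Rightarrow> bool" where
  "factors_through C m n \<longleftrightarrow> (\<exists>u\<in>Hom C (Dom C m) (Dom C n). n \<cdot>\<^bsub>C\<^esub> u = m)"

definition sub_class :: "('o, 'm) precategory \<Rightarrow> 'm \<Rightarrow> 'm set" where
  "sub_class C m =
     {n \<in> monos_into C (Cod C m). factors_through C m n \<and> factors_through C n m}"

definition subobjects :: "('o, 'm) precategory \<Rightarrow> 'o \<Rightarrow> 'm set set" where
  "subobjects C A = sub_class C ` monos_into C A"

definition subobject_order :: "('o, 'm) precategory \<Rightarrow> 'o \<Rightarrow> 'm set gorder" where
  "subobject_order C A =
     \<lparr> carrier = subobjects C A, eq = (=),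
       le = (\<lambda>p q. \<exists>m\<in>p. \<exists>n\<in>q. factors_through C m n) \<rparr>"

definition small_homs :: "'k rel \<Rightarrow> ('o, 'm) precategory \<Rightarrow> bool" where
  "small_homs \<kappa> C \<longleftrightarrow> (\<forall>A\<in>Obj C. \<forall>B\<in>Obj C. small \<kappa> (Hom C A B))"

text \<open>``Locally small'' in the sense of small subobject classes (also called well-powered).\<close>

definition locally_small :: "'k rel \<Rightarrow> ('o, 'm) precategory \<Rightarrow> bool" where
  "locally_small \<kappa> C \<longleftrightarrow> (\<forall>A\<in>Obj C. small \<kappa> (subobjects C A))"


section \<open>Preradicals\<close>

definition Pr :: "('o, 'm) precategory \<Rightarrow> ('o, 'm, 'o, 'm) ntrans set gorder" where
  "Pr C = subobject_order (Fun C C) (id_ftor C)"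

definition whisker :: "('o, 'm) precategory \<Rightarrow> ('o, 'm, 'o, 'm) ntrans \<Rightarrow>
    ('o, 'm, 'o, 'm) ftor \<Rightarrow> ('o, 'm, 'o, 'm) ntrans" where
  "whisker C \<tau> S =
     \<lparr> Src = comp_ftor C (Src \<tau>) S, Trg = comp_ftor C (Trg \<tau>) S,
       Cmp = restrict (\<lambda>A. Cmp \<tau> (Fo S A)) (Obj C) \<rparr>"

text \<open>The product of two classes is the class of \<open>\<sigma> \<circ> \<tau>S\<close> for any choice of representatives.\<close>

definition pr_mult :: "('o, 'm) precategory \<Rightarrow> ('o, 'm, 'o, 'm) ntrans set \<Rightarrow>
    ('o, 'm, 'o, 'm) ntrans set \<Rightarrow> ('o, 'm, 'o, 'm) ntrans set" where
  "pr_mult C p q =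
     (\<Union>\<tau>\<in>p. \<Union>\<sigma>\<in>q. sub_class (Fun C C) (\<sigma> \<cdot>\<^bsub>Fun C C\<^esub> whisker C \<tau> (Src \<sigma>)))"

definition pr_idempotent :: "('o, 'm) precategory \<Rightarrow> ('o, 'm, 'o, 'm) ntrans set \<Rightarrow> bool" where
  "pr_idempotent C p \<longleftrightarrow> pr_mult C p p = p"

definition torsion_objects :: "('o, 'm) precategory \<Rightarrow> ('o, 'm, 'o, 'm) ntrans \<Rightarrow> 'o set" where
  "torsion_objects C \<tau> = {M \<in> Obj C. is_iso C (Cmp \<tau> M)}"


section \<open>Alpha preradicals\<close>

definition is_copower :: "('o, 'm) precategory \<Rightarrow> 'i set \<Rightarrow> 'o \<Rightarrow> 'o \<Rightarrow> ('i \<Rightarrow> 'm) \<Rightarrow> bool" where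
  "is_copower C I N P i \<longleftrightarrow> P \<in> Obj C \<and> (\<forall>x\<in>I. i x \<in> Hom C N P) \<and>
     (\<forall>Q\<in>Obj C. \<forall>j. (\<forall>x\<in>I. j x \<in> Hom C N Q) \<longrightarrow>
        (\<exists>!u. u \<in> Hom C P Q \<and> (\<forall>x\<in>I. u \<cdot>\<^bsub>C\<^esub> i x = j x)))"

definition copower :: "('o, 'm) precategory \<Rightarrow> 'i set \<Rightarrow> 'o \<Rightarrow> 'o \<times> ('i \<Rightarrow> 'm)" where
  "copower C I N = (SOME (P, i). is_copower C I N P i)"

definition alpha_obj :: "('o, 'm) precategory \<Rightarrow> 'o \<Rightarrow> 'o \<Rightarrow> 'o \<Rightarrow> 'o" where
  "alpha_obj C N M L = fst (copower C (Hom C M L) N)"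

definition alpha_inj :: "('o, 'm) precategory \<Rightarrow> 'o \<Rightarrow> 'o \<Rightarrow> 'o \<Rightarrow> 'm \<Rightarrow> 'm" where
  "alpha_inj C N M L = snd (copower C (Hom C M L) N)"

definition alpha_ftor :: "('o, 'm) precategory \<Rightarrow> 'o \<Rightarrow> 'o \<Rightarrow> ('o, 'm, 'o, 'm) ftor" where
  "alpha_ftor C N M =
     \<lparr> Fo = restrict (alpha_obj C N M) (Obj C),
       Fa = restrict (\<lambda>l. THE u.
              u \<in> Hom C (alpha_obj C N M (Dom C l)) (alpha_obj C N M (Cod C l)) \<and>
              (\<forall>f\<in>Hom C M (Dom C l).
                 u \<cdot>\<^bsub>C\<^esub> alpha_inj C N M (Dom C l) f = alpha_inj C N M (Cod C l) (l \<cdot>\<^bsub>C\<^esub> f)))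
            (Arr C) \<rparr>"

definition alpha_ntrans :: "('o, 'm) precategory \<Rightarrow> 'm \<Rightarrow> ('o, 'm, 'o, 'm) ntrans" where
  "alpha_ntrans C h = (let N = Dom C h; M = Cod C h in
     \<lparr> Src = alpha_ftor C N M, Trg = id_ftor C,
       Cmp = restrict (\<lambda>L. THE u. u \<in> Hom C (alpha_obj C N M L) L \<and>
               (\<forall>f\<in>Hom C M L. u \<cdot>\<^bsub>C\<^esub> alpha_inj C N M L f = f \<cdot>\<^bsub>C\<^esub> h))
             (Obj C) \<rparr>)"

text \<open>All images of an arrow form one equivalence class of monomorphisms, hence a subobject.\<close>

definition alpha_pr :: "('o, 'm) precategory \<Rightarrow> 'm \<Rightarrow> ('o, 'm, 'o, 'm) ntrans set" where
  "alpha_pr C h = {m. is_image (Fun C C) m (alpha_ntrans C h)}"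

end

theory Submission
  imports Defs
begin

text \<open>
  Everything rests on the equivalence \<open>\<alpha>\<^bsub>1\<^sub>M\<^esub> \<le> \<sigma> \<longleftrightarrow> M \<in> \<T>\<^sub>\<sigma>\<close>, for any preradical
  \<open>\<sigma> : S \<hookrightarrow> 1\<close>. If \<open>\<sigma>\<^sub>M\<close> has an inverse \<open>u\<close>, then each \<open>f : M \<rightarrow> L\<close> equals \<open>\<sigma>\<^sub>L \<circ> S(f) \<circ> u\<close>, so the
  natural transformation defining \<open>\<alpha>\<^bsub>1\<^sub>M\<^esub>\<close>, and with it its image, factors through \<open>\<sigma>\<close>; conversely, the
  component at \<open>M\<close> restricted to the summand of \<open>1\<^sub>M\<close> is \<open>1\<^sub>M\<close>, which makes \<open>\<sigma>\<^sub>M\<close> split epi.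

  Hence \<open>\<tau>\<close> is the join in question iff \<open>\<tau> \<le> \<sigma>\<close> whenever \<open>\<T>\<^sub>\<tau> \<subseteq> \<T>\<^sub>\<sigma>\<close>. This condition applies to
  \<open>\<sigma> = \<tau> \<cdot> \<tau>\<close>, which gives idempotence. If \<open>\<tau>\<close> is idempotent, then \<open>T(A) \<in> \<T>\<^sub>\<tau> \<subseteq> \<T>\<^sub>\<sigma>\<close> for all \<open>A\<close>, and
  naturality of \<open>\<sigma>\<close> at \<open>\<tau>\<^sub>A\<close> makes \<open>\<tau>\<^sub>A\<close> factor through \<open>\<sigma>\<^sub>A\<close>.
\<close>

section \<open>Kernels, images and subobjects\<close>

lemma Hom_iff: "f \<in> Hom C A B \<longleftrightarrow> f \<in> Arr C \<and> Dom C f = A \<and> Cod C f = B"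
  by (simp add: Hom_def)

lemma HomD:
  assumes "f \<in> Hom C A B"
  shows "f \<in> Arr C" "Dom C f = A" "Cod C f = B"
  using assms by (auto simp: Hom_iff)

lemma Arr_Hom: "f \<in> Arr C \<Longrightarrow> f \<in> Hom C (Dom C f) (Cod C f)"
  by (simp add: Hom_iff)

section \<open>Monomorphisms, epimorphisms and isomorphisms\<close>

context category
begin

lemma Hom_Obj:
  assumes "f \<in> Hom C A B"
  shows "A \<in> Obj C" "B \<in> Obj C"
  using assms Dom_closed Cod_closed by (auto simp: Hom_iff)

lemma is_mono_iff:
  assumes "m \<in> Hom C A B"
  shows "is_mono C m \<longleftrightarrow>
    (\<forall>X. \<forall>g\<in>Hom C X A. \<forall>h\<in>Hom C X A. m \<cdot> g = m \<cdot> h \<longrightarrow> g = h)"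
  using assms unfolding is_mono_def Ball_def Bex_def Hom_iff by auto

lemma is_epi_iff:
  assumes "e \<in> Hom C A B"
  shows "is_epi C e \<longleftrightarrow>
    (\<forall>X. \<forall>g\<in>Hom C B X. \<forall>h\<in>Hom C B X. g \<cdot> e = h \<cdot> e \<longrightarrow> g = h)"
  using assms unfolding is_epi_def Ball_def Bex_def Hom_iff by auto

lemma mono_cancel:
  assumes "is_mono C m" "m \<in> Hom C A B" "g \<in> Hom C X A" "h \<in> Hom C X A" "m \<cdot> g = m \<cdot> h"
  shows "g = h"
  using assms is_mono_iff by blast

lemma epi_cancel:
  assumes "is_epi C e" "e \<in> Hom C A B" "g \<in> Hom C B X" "h \<in> Hom C B X" "g \<cdot> e = h \<cdot> e"
  shows "g = h"
  using assms is_epi_iff by blast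

lemma mono_comp:
  assumes m: "is_mono C m" "m \<in> Hom C A B" and n: "is_mono C n" "n \<in> Hom C B D"
  shows "is_mono C (n \<cdot> m)"
  unfolding is_mono_iff[OF Comp_closed[OF m(2) n(2)]]
proof (intro allI ballI impI)
  fix X g h assume g: "g \<in> Hom C X A" and h: "h \<in> Hom C X A" and e: "(n \<cdot> m) \<cdot> g = (n \<cdot> m) \<cdot> h"
  have "n \<cdot> (m \<cdot> g) = n \<cdot> (m \<cdot> h)"
    using e Comp_assoc[OF g m(2) n(2)] Comp_assoc[OF h m(2) n(2)] by simp
  then have "m \<cdot> g = m \<cdot> h"
    using mono_cancel[OF n] Comp_closed g h m(2) by blast
  then show "g = h" using mono_cancel[OF m g h] by blast
qed

lemma is_iso_iff:
  assumes "f \<in> Hom C A B"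
  shows "is_iso C f \<longleftrightarrow> (\<exists>g\<in>Hom C B A. g \<cdot> f = Idn C A \<and> f \<cdot> g = Idn C B)"
  using assms unfolding is_iso_def by (auto simp: Ball_def Bex_def Hom_iff)

text \<open>Both \<open>m \<cdot> (u \<cdot> m)\<close> and \<open>m \<cdot> Idn C A\<close> equal
  \<open>m\<close>, so cancelling \<open>m\<close> turns the right inverse \<open>u\<close> into a
  two-sided one.\<close>

lemma mono_split_epi_is_iso:
  assumes m: "is_mono C m" "m \<in> Hom C A B" and u: "u \<in> Hom C B A" "m \<cdot> u = Idn C B"
  shows "is_iso C m"
proof -
  have "m \<cdot> (u \<cdot> m) = m \<cdot> Idn C A"
    using Comp_assoc[OF m(2) u(1) m(2)] u(2) Idn_Comp[OF m(2)] Comp_Idn[OF m(2)] by simp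
  then have "u \<cdot> m = Idn C A"
    using mono_cancel[OF m Comp_closed[OF m(2) u(1)] Idn_closed] Hom_Obj[OF m(2)] by blast
  then show ?thesis
    using u is_iso_iff[OF m(2)] by blast
qed

section \<open>Zero objects and zero arrows\<close>

lemma zero_object_Obj: "zero_object C Z \<Longrightarrow> Z \<in> Obj C"
  by (simp add: zero_object_def)

lemma zero_object_ex:
  assumes "zero_object C Z" "A \<in> Obj C"
  shows "\<exists>f. f \<in> Hom C A Z" "\<exists>f. f \<in> Hom C Z A"
  using assms unfolding zero_object_def by (metis (no_types))+

lemma zero_object_unique:
  assumes "zero_object C Z"
  shows "f \<in> Hom C A Z \<Longrightarrow> g \<in> Hom C A Z \<Longrightarrow> f = g"
    and "f \<in> Hom C Z A \<Longrightarrow> g \<in> Hom C Z A \<Longrightarrow> f = g"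
  using assms Hom_Obj unfolding zero_object_def by (metis (no_types))+

text \<open>The definition lets the zero object vary with the arrow. The unique arrows between two
  zero objects compose to the identity, which moves any factorisation to the fixed
  \<open>Z\<close>.\<close>

lemma zero_arrow_iff:
  assumes Z: "zero_object C Z" and f: "f \<in> Hom C A B"
  shows "zero_arrow C f \<longleftrightarrow> (\<exists>g\<in>Hom C A Z. \<exists>h\<in>Hom C Z B. f = h \<cdot> g)"
proof
  assume "zero_arrow C f"
  then obtain Z' g h where Z': "zero_object C Z'"
    and g: "g \<in> Hom C A Z'" and h: "h \<in> Hom C Z' B" and e: "f = h \<cdot> g"
    unfolding zero_arrow_def HomD[OF f] by (elim conjE exE bexE)
  obtain s t where s: "s \<in> Hom C Z' Z" and t: "t \<in> Hom C Z Z'"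
    using zero_object_ex(1)[OF Z zero_object_Obj[OF Z']] zero_object_ex(2)[OF Z zero_object_Obj[OF Z']]
    by blast
  have "t \<cdot> s = Idn C Z'"
    using zero_object_unique(1)[OF Z' Comp_closed[OF s t] Idn_closed[OF zero_object_Obj[OF Z']]] .
  then have "f = (h \<cdot> t) \<cdot> (s \<cdot> g)"
    using Comp_assoc[OF Comp_closed[OF g s] t h] Comp_assoc[OF g s t] Idn_Comp[OF g] e by simp
  then show "\<exists>g\<in>Hom C A Z. \<exists>h\<in>Hom C Z B. f = h \<cdot> g"
    using Comp_closed[OF g s] Comp_closed[OF t h] by blast
next
  assume "\<exists>g\<in>Hom C A Z. \<exists>h\<in>Hom C Z B. f = h \<cdot> g"
  then show "zero_arrow C f"
    unfolding zero_arrow_def HomD(2,3)[OF f] by (intro conjI exI[of _ Z] HomD(1)[OF f] Z)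
qed

lemma zero_arrow_postcomp:
  assumes z: "zero_arrow C f" and f: "f \<in> Hom C A B" and g: "g \<in> Hom C B D"
  shows "zero_arrow C (g \<cdot> f)"
proof -
  obtain Z where Z: "zero_object C Z" using z unfolding zero_arrow_def by blast
  obtain a b where ab: "a \<in> Hom C A Z" "b \<in> Hom C Z B" "f = b \<cdot> a"
    using z zero_arrow_iff[OF Z f] by blast
  then have "g \<cdot> f = (g \<cdot> b) \<cdot> a" using Comp_assoc[OF ab(1,2) g] by simp
  then show ?thesis
    using zero_arrow_iff[OF Z Comp_closed[OF f g]] ab(1) Comp_closed[OF ab(2) g] by blast
qed

lemma zero_arrow_precomp:
  assumes z: "zero_arrow C g" and f: "f \<in> Hom C A B" and g: "g \<in> Hom C B D"
  shows "zero_arrow C (g \<cdot> f)"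
proof -
  obtain Z where Z: "zero_object C Z" using z unfolding zero_arrow_def by blast
  obtain a b where ab: "a \<in> Hom C B Z" "b \<in> Hom C Z D" "g = b \<cdot> a"
    using z zero_arrow_iff[OF Z g] by blast
  then have "g \<cdot> f = b \<cdot> (a \<cdot> f)" using Comp_assoc[OF f ab(1,2)] by simp
  then show ?thesis
    using zero_arrow_iff[OF Z Comp_closed[OF f g]] ab(2) Comp_closed[OF f ab(1)] by blast
qed

text \<open>Both arrows factor through one common zero object, where the two legs admit no choice.
  This replaces the appeal to an additive zero.\<close>

lemma zero_arrow_unique:
  assumes "zero_arrow C f" "f \<in> Hom C A B" "zero_arrow C g" "g \<in> Hom C A B"
  shows "f = g"
proof -
  obtain Z where Z: "zero_object C Z" using assms(1) unfolding zero_arrow_def by blast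
  obtain a b where ab: "a \<in> Hom C A Z" "b \<in> Hom C Z B" "f = b \<cdot> a"
    using assms(1) zero_arrow_iff[OF Z assms(2)] by blast
  obtain a' b' where ab': "a' \<in> Hom C A Z" "b' \<in> Hom C Z B" "g = b' \<cdot> a'"
    using assms(3) zero_arrow_iff[OF Z assms(4)] by blast
  show ?thesis
    using zero_object_unique(1)[OF Z ab(1) ab'(1)] zero_object_unique(2)[OF Z ab(2) ab'(2)] ab(3) ab'(3)
    by simp
qed

lemma zero_arrow_exists:
  assumes Z: "zero_object C Z" and "A \<in> Obj C" "B \<in> Obj C"
  shows "\<exists>f\<in>Hom C A B. zero_arrow C f"
proof -
  obtain a b where "a \<in> Hom C A Z" "b \<in> Hom C Z B"
    using zero_object_ex[OF Z] assms by blast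
  then show ?thesis using Comp_closed[of a A Z b B] zero_arrow_iff[OF Z, of "b \<cdot> a" A B] by blast
qed

section \<open>Kernels and cokernels\<close>

text \<open>Uniqueness of factorisations is traded for monicity of \<open>k\<close>. In a functor
  category monicity and existence can then be checked separately and objectwise.\<close>

lemma is_kernelI:
  assumes f: "f \<in> Hom C A B" and k: "k \<in> Hom C K A" and "is_mono C k" and "zero_arrow C (f \<cdot> k)"
    and fac: "\<And>X g. g \<in> Hom C X A \<Longrightarrow> zero_arrow C (f \<cdot> g) \<Longrightarrow> \<exists>u\<in>Hom C X K. k \<cdot> u = g"
  shows "is_kernel C k f"
proof -
  have "\<exists>!u. u \<in> Hom C (Dom C g) (Dom C k) \<and> k \<cdot> u = g"
    if "g \<in> Arr C" "Cod C g = Dom C f" "zero_arrow C (f \<cdot> g)" for g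
  proof -
    have g: "g \<in> Hom C (Dom C g) A" using that f by (simp add: Hom_iff)
    show ?thesis
      unfolding HomD(2)[OF k] using fac[OF g that(3)] mono_cancel[OF \<open>is_mono C k\<close> k] by blast
  qed
  then show ?thesis
    using HomD[OF f] HomD[OF k] \<open>zero_arrow C (f \<cdot> k)\<close> unfolding is_kernel_def by simp
qed

lemma is_kernelD:
  assumes "is_kernel C k f"
  shows "k \<in> Hom C (Dom C k) (Dom C f)" "f \<in> Hom C (Dom C f) (Cod C f)" "is_mono C k"
    "zero_arrow C (f \<cdot> k)"
    "\<And>X g. g \<in> Hom C X (Dom C f) \<Longrightarrow> zero_arrow C (f \<cdot> g) \<Longrightarrow> \<exists>u\<in>Hom C X (Dom C k). k \<cdot> u = g"
proof -
  show k: "k \<in> Hom C (Dom C k) (Dom C f)" and f: "f \<in> Hom C (Dom C f) (Cod C f)"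
    and z: "zero_arrow C (f \<cdot> k)"
    using assms unfolding is_kernel_def by (simp_all add: Hom_iff)
  have ex1: "\<exists>!u. u \<in> Hom C X (Dom C k) \<and> k \<cdot> u = g"
    if "g \<in> Hom C X (Dom C f)" "zero_arrow C (f \<cdot> g)" for X g
    using HomD[OF that(1)] that(2) assms unfolding is_kernel_def by metis
  then show "\<exists>u\<in>Hom C X (Dom C k). k \<cdot> u = g"
    if "g \<in> Hom C X (Dom C f)" "zero_arrow C (f \<cdot> g)" for X g
    using that by blast
  show "is_mono C k"
    unfolding is_mono_iff[OF k]
  proof (intro allI ballI impI)
    fix X g h assume g: "g \<in> Hom C X (Dom C k)" and h: "h \<in> Hom C X (Dom C k)" and e: "k \<cdot> g = k \<cdot> h"
    \<comment> \<open>The composite \<open>k \<cdot> g\<close> is itself killed by \<open>f\<close>,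
      and both \<open>g\<close> and \<open>h\<close> factor it through \<open>k\<close>, so the
      unique factorisation identifies them.\<close>
    have "zero_arrow C (f \<cdot> (k \<cdot> g))"
      using zero_arrow_precomp[OF z g Comp_closed[OF k f]] Comp_assoc[OF g k f] by simp
    with ex1[OF Comp_closed[OF g k]] g h e show "g = h" by metis
  qed
qed

lemma is_cokernelI:
  assumes f: "f \<in> Hom C A B" and c: "c \<in> Hom C B Q" and "is_epi C c" and "zero_arrow C (c \<cdot> f)"
    and fac: "\<And>X g. g \<in> Hom C B X \<Longrightarrow> zero_arrow C (g \<cdot> f) \<Longrightarrow> \<exists>u\<in>Hom C Q X. u \<cdot> c = g"
  shows "is_cokernel C c f"
proof -
  have "\<exists>!u. u \<in> Hom C (Cod C c) (Cod C g) \<and> u \<cdot> c = g"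
    if "g \<in> Arr C" "Dom C g = Cod C f" "zero_arrow C (g \<cdot> f)" for g
  proof -
    have g: "g \<in> Hom C B (Cod C g)" using that f by (simp add: Hom_iff)
    show ?thesis
      unfolding HomD(3)[OF c] using fac[OF g that(3)] epi_cancel[OF \<open>is_epi C c\<close> c] by blast
  qed
  then show ?thesis
    using HomD[OF f] HomD[OF c] \<open>zero_arrow C (c \<cdot> f)\<close> unfolding is_cokernel_def by simp
qed

lemma is_cokernelD:
  assumes "is_cokernel C c f"
  shows "c \<in> Hom C (Cod C f) (Cod C c)" "f \<in> Hom C (Dom C f) (Cod C f)" "is_epi C c"
    "zero_arrow C (c \<cdot> f)"
    "\<And>X g. g \<in> Hom C (Cod C f) X \<Longrightarrow> zero_arrow C (g \<cdot> f) \<Longrightarrow> \<exists>u\<in>Hom C (Cod C c) X. u \<cdot> c = g"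
proof -
  show c: "c \<in> Hom C (Cod C f) (Cod C c)" and f: "f \<in> Hom C (Dom C f) (Cod C f)"
    and z: "zero_arrow C (c \<cdot> f)"
    using assms unfolding is_cokernel_def by (simp_all add: Hom_iff)
  have ex1: "\<exists>!u. u \<in> Hom C (Cod C c) X \<and> u \<cdot> c = g"
    if "g \<in> Hom C (Cod C f) X" "zero_arrow C (g \<cdot> f)" for X g
    using HomD[OF that(1)] that(2) assms unfolding is_cokernel_def by metis
  then show "\<exists>u\<in>Hom C (Cod C c) X. u \<cdot> c = g"
    if "g \<in> Hom C (Cod C f) X" "zero_arrow C (g \<cdot> f)" for X g
    using that by blast
  show "is_epi C c"
    unfolding is_epi_iff[OF c]
  proof (intro allI ballI impI)
    fix X g h assume g: "g \<in> Hom C (Cod C c) X" and h: "h \<in> Hom C (Cod C c) X" and e: "g \<cdot> c = h \<cdot> c"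
    have "zero_arrow C ((g \<cdot> c) \<cdot> f)"
      using zero_arrow_postcomp[OF z Comp_closed[OF f c] g] Comp_assoc[OF f c g] by simp
    with ex1[OF Comp_closed[OF c g]] g h e show "g = h" by metis
  qed
qed

text \<open>Since \<open>f\<close> kills \<open>m\<close>, it factors as \<open>v \<cdot> c\<close>.
  Hence whatever \<open>c\<close> kills is also killed by \<open>f\<close> and lifts along
  \<open>m\<close>. For a monomorphism in an abelian category this replaces an unspecified
  \<open>f\<close> by the cokernel.\<close>

lemma kernel_of_cokernel:
  assumes k: "is_kernel C m f" and c: "is_cokernel C c m"
  shows "is_kernel C m c"
proof -
  note k = is_kernelD[OF k] and c = is_cokernelD[OF c]
  have "Cod C m = Dom C f" using k(1) by (simp add: Hom_iff)
  note c = c[unfolded this]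
  obtain v where v: "v \<in> Hom C (Cod C c) (Cod C f)" "v \<cdot> c = f"
    using c(5)[OF k(2,4)] by blast
  show ?thesis
  proof (rule is_kernelI[OF c(1) k(1,3) c(4)])
    fix X g assume g: "g \<in> Hom C X (Dom C f)" and z: "zero_arrow C (c \<cdot> g)"
    have "zero_arrow C (f \<cdot> g)"
      using zero_arrow_postcomp[OF z Comp_closed[OF g c(1)] v(1)] Comp_assoc[OF g c(1) v(1)] v(2)
      by simp
    then show "\<exists>u\<in>Hom C X (Dom C m). m \<cdot> u = g" using k(5)[OF g] by blast
  qed
qed

section \<open>Subobjects as classes of monomorphisms\<close>

lemma factors_through_trans:
  assumes "factors_through C l m" "factors_through C m n"
    and "m \<in> Arr C" "n \<in> Arr C" "Cod C m = Cod C n"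
  shows "factors_through C l n"
proof -
  obtain u where u: "u \<in> Hom C (Dom C l) (Dom C m)" "m \<cdot> u = l"
    using assms(1) unfolding factors_through_def by blast
  obtain v where v: "v \<in> Hom C (Dom C m) (Dom C n)" "n \<cdot> v = m"
    using assms(2) unfolding factors_through_def by blast
  have "n \<cdot> (v \<cdot> u) = l"
    using Comp_assoc[OF u(1) v(1), of n "Cod C n"] assms(4) u v by (simp add: Hom_iff)
  then show ?thesis using Comp_closed[OF u(1) v(1)] unfolding factors_through_def by blast
qed

lemma factors_through_refl:
  assumes "m \<in> Arr C"
  shows "factors_through C m m"
  using assms Comp_Idn[of m "Dom C m" "Cod C m"] Idn_closed[OF Dom_closed[OF assms]]
  unfolding factors_through_def by (auto simp: Ball_def Bex_def Hom_iff)

lemma monos_intoD: "m \<in> monos_into C A \<Longrightarrow> is_mono C m \<and> m \<in> Hom C (Dom C m) A"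
  unfolding monos_into_def is_mono_def by (simp add: Hom_iff)

lemma mem_sub_class:
  assumes "m \<in> monos_into C A"
  shows "n \<in> sub_class C m \<longleftrightarrow>
    n \<in> monos_into C A \<and> factors_through C m n \<and> factors_through C n m"
  using assms unfolding sub_class_def monos_into_def by auto

lemma self_mem_sub_class: "m \<in> monos_into C A \<Longrightarrow> m \<in> sub_class C m"
  using mem_sub_class factors_through_refl unfolding monos_into_def is_mono_def by blast

lemma factors_through_trans_monos:
  assumes "factors_through C l m" "factors_through C m n"
    and "m \<in> monos_into C A" "n \<in> monos_into C A"
  shows "factors_through C l n"
  using factors_through_trans[OF assms(1,2)] assms(3,4) monos_intoD by (auto simp: Hom_iff)

lemma sub_class_eq_iff:
  assumes "m \<in> monos_into C A" "n \<in> monos_into C A"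
  shows "sub_class C m = sub_class C n \<longleftrightarrow> factors_through C m n \<and> factors_through C n m"
proof
  assume "sub_class C m = sub_class C n"
  then show "factors_through C m n \<and> factors_through C n m"
    using self_mem_sub_class[OF assms(1)] mem_sub_class[OF assms(2)] by blast
next
  assume a: "factors_through C m n \<and> factors_through C n m"
  then have "l \<in> sub_class C m \<longleftrightarrow> l \<in> sub_class C n" for l
    using factors_through_trans_monos[of l] factors_through_trans_monos[of _ _ l]
      mem_sub_class[OF assms(1), of l] mem_sub_class[OF assms(2), of l] assms by blast
  then show "sub_class C m = sub_class C n" by blast
qed

text \<open>The order on classes only asks for some pair of representatives; transitivity of
  factorisation carries such a pair over to the given \<open>m\<close> and \<open>n\<close>.\<close>

lemma subobject_order_le_iff:
  assumes "m \<in> monos_into C A" "n \<in> monos_into C A"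
  shows "sub_class C m \<sqsubseteq>\<^bsub>subobject_order C A\<^esub> sub_class C n \<longleftrightarrow> factors_through C m n"
proof
  assume "sub_class C m \<sqsubseteq>\<^bsub>subobject_order C A\<^esub> sub_class C n"
  then obtain m' n' where mn: "m' \<in> sub_class C m" "n' \<in> sub_class C n" "factors_through C m' n'"
    unfolding subobject_order_def by auto
  then have "factors_through C m n'"
    using factors_through_trans_monos[of m m' n'] mem_sub_class[OF assms(1), of m']
      mem_sub_class[OF assms(2), of n'] by blast
  then show "factors_through C m n"
    using factors_through_trans_monos[of m n' n] mn mem_sub_class[OF assms(2), of n'] assms by blast
next
  assume "factors_through C m n"
  then show "sub_class C m \<sqsubseteq>\<^bsub>subobject_order C A\<^esub> sub_class C n"
    using self_mem_sub_class assms unfolding subobject_order_def by auto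
qed

section \<open>Images\<close>

lemma image_mono:
  assumes "is_image C m f"
  shows "m \<in> monos_into C (Cod C f)"
proof -
  obtain c where c: "is_cokernel C c f" and m: "is_kernel C m c"
    using assms unfolding is_image_def by blast
  have "Dom C c = Cod C f" using c unfolding is_cokernel_def by blast
  then show ?thesis using is_kernelD[OF m] unfolding monos_into_def Hom_iff by simp
qed

text \<open>The two images may stem from different cokernels \<open>c\<close> and \<open>c'\<close>
  of \<open>f\<close>. As \<open>c'\<close> kills \<open>f\<close>, it factors through
  \<open>c\<close>, so it kills the kernel \<open>m\<close> of \<open>c\<close>, and
  \<open>m\<close> lifts along \<open>m'\<close>.\<close>

lemma image_le:
  assumes "is_image C m f" "is_image C m' f"
  shows "factors_through C m m'"
proof -
  obtain c where c: "is_cokernel C c f" and m: "is_kernel C m c"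
    using assms unfolding is_image_def by blast
  obtain c' where c': "is_cokernel C c' f" and m': "is_kernel C m' c'"
    using assms unfolding is_image_def by blast
  have d: "Dom C c = Cod C f" "Dom C c' = Cod C f" using c c' unfolding is_cokernel_def by auto
  note c = is_cokernelD[OF c] and c' = is_cokernelD[OF c']
  note m = is_kernelD[OF m, unfolded d] and m' = is_kernelD[OF m', unfolded d]
  obtain v where v: "v \<in> Hom C (Cod C c) (Cod C c')" "v \<cdot> c = c'"
    using c(5)[OF c'(1,4)] by blast
  have "zero_arrow C (c' \<cdot> m)"
    using zero_arrow_postcomp[OF m(4) Comp_closed[OF m(1,2)] v(1)] Comp_assoc[OF m(1,2) v(1)] v(2)
    by simp
  then show ?thesis using m'(5)[OF m(1)] unfolding factors_through_def by blast
qed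

text \<open>Justifies treating \<open>alpha_pr\<close> as a subobject. Any two images factor through
  each other, and a monomorphism equivalent to an image is a kernel of the same cokernel.\<close>

lemma images_eq_sub_class:
  assumes "is_image C m f"
  shows "{n. is_image C n f} = sub_class C m"
proof -
  have mono: "m \<in> monos_into C (Cod C f)" using image_mono[OF assms] .
  have "is_image C n f" if n: "n \<in> monos_into C (Cod C f)" "factors_through C m n" "factors_through C n m" for n
  proof -
    obtain c where c: "is_cokernel C c f" and m: "is_kernel C m c"
      using assms unfolding is_image_def by blast
    have d: "Dom C c = Cod C f" using c unfolding is_cokernel_def by auto
    note m = is_kernelD[OF m, unfolded d]
    have n1: "is_mono C n" "n \<in> Hom C (Dom C n) (Cod C f)" using monos_intoD[OF n(1)] by auto
    obtain u where u: "u \<in> Hom C (Dom C m) (Dom C n)" "n \<cdot> u = m"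
      using n(2) unfolding factors_through_def by blast
    obtain v where v: "v \<in> Hom C (Dom C n) (Dom C m)" "m \<cdot> v = n"
      using n(3) unfolding factors_through_def by blast
    have z: "zero_arrow C (c \<cdot> n)"
      using zero_arrow_precomp[OF m(4) v(1) Comp_closed[OF m(1,2)]] Comp_assoc[OF v(1) m(1,2)] v(2)
      by simp
    have "is_kernel C n c"
    proof (rule is_kernelI[OF m(2) n1(2,1) z])
      fix X g assume "g \<in> Hom C X (Cod C f)" "zero_arrow C (c \<cdot> g)"
      then obtain w where w: "w \<in> Hom C X (Dom C m)" "m \<cdot> w = g" using m(5) by blast
      then have "n \<cdot> (u \<cdot> w) = g" using Comp_assoc[OF w(1) u(1) n1(2)] u(2) by simp
      then show "\<exists>u\<in>Hom C X (Dom C n). n \<cdot> u = g" using Comp_closed[OF w(1) u(1)] by blast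
    qed
    then show ?thesis using c unfolding is_image_def by blast
  qed
  then show ?thesis
    using mem_sub_class[OF mono] image_mono image_le[OF assms] image_le[OF _ assms] by blast
qed

lemma factors_through_image:
  assumes "is_image C m f"
  shows "factors_through C f m"
proof -
  obtain c where c: "is_cokernel C c f" and m: "is_kernel C m c"
    using assms unfolding is_image_def by blast
  have d: "Dom C c = Cod C f" using c unfolding is_cokernel_def by auto
  show ?thesis
    using is_kernelD(5)[OF m, unfolded d, OF is_cokernelD(2)[OF c] is_cokernelD(4)[OF c]]
    unfolding factors_through_def .
qed

end

lemma (in category) factors_through_iff:
  assumes "m \<in> Hom C A X" "n \<in> Hom C B Y"
  shows "factors_through C m n \<longleftrightarrow> (\<exists>u\<in>Hom C A B. n \<cdot> u = m)"
  unfolding factors_through_def HomD(2)[OF assms(1)] HomD(2)[OF assms(2)] ..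

section \<open>Zero arrows and addition; minimality of images\<close>

text \<open>Reconciles the two notions of zero. Only one arrow \<open>a\<close> leads from
  \<open>A\<close> to \<open>Z\<close>, so \<open>add a a = a\<close>; composing with
  \<open>b\<close> gives \<open>add g g = g\<close> for the zero arrow \<open>g\<close>, and in a
  group this forces \<open>g\<close> to be neutral.\<close>

lemma (in category) preadditive_group_one:
  assumes pre: "preadditive C add" and Z: "zero_object C Z" and f: "f \<in> Hom C A B"
    and grp: "comm_group \<lparr> carrier = Hom C A B, monoid.mult = add, one = z \<rparr>"
  shows "zero_arrow C f \<longleftrightarrow> f = z"
proof -
  interpret G: comm_group "\<lparr> carrier = Hom C A B, monoid.mult = add, one = z \<rparr>" by (rule grp)
  have z: "z \<in> Hom C A B" using G.one_closed by simp
  note AB = Hom_Obj[OF f]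
  obtain g where g: "g \<in> Hom C A B" "zero_arrow C g"
    using zero_arrow_exists[OF Z AB] by blast
  obtain a b where ab: "a \<in> Hom C A Z" "b \<in> Hom C Z B" "g = b \<cdot> a"
    using g zero_arrow_iff[OF Z g(1)] by blast
  obtain y where "comm_group \<lparr> carrier = Hom C A Z, monoid.mult = add, one = y \<rparr>"
    using pre AB(1) zero_object_Obj[OF Z] unfolding preadditive_def by blast
  then interpret H: comm_group "\<lparr> carrier = Hom C A Z, monoid.mult = add, one = y \<rparr>" .
  have "add a a = a"
    using H.m_closed[of a a] ab(1) zero_object_unique(1)[OF Z, of "add a a" A a] by simp
  moreover have "b \<cdot> add a a = add (b \<cdot> a) (b \<cdot> a)"
    using pre AB zero_object_Obj[OF Z] ab(1,2) unfolding preadditive_def by blast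
  ultimately have "add g g = g" using ab(3) by simp
  then have "g = z" using G.r_cancel_one[of g g] g(1) by simp
  then show ?thesis using g zero_arrow_unique[of f A B g] f by blast
qed

text \<open>If \<open>f\<close> identifies \<open>g\<close> and \<open>h\<close>, then it kills
  their difference \<open>add g ?h\<close>, with \<open>?h\<close> the additive inverse of
  \<open>h\<close>. The difference is then a zero arrow, hence neutral in its hom-group.\<close>

lemma (in category) preadditive_monoI:
  assumes pre: "preadditive C add" and Z: "zero_object C Z" and f: "f \<in> Hom C A B"
    and ker: "\<And>X g. g \<in> Hom C X A \<Longrightarrow> zero_arrow C (f \<cdot> g) \<Longrightarrow> zero_arrow C g"
  shows "is_mono C f"
  unfolding is_mono_iff[OF f]
proof (intro allI ballI impI)
  fix X g h assume g: "g \<in> Hom C X A" and h: "h \<in> Hom C X A" and eq: "f \<cdot> g = f \<cdot> h"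
  note XA = Hom_Obj[OF g] and BO = Hom_Obj(2)[OF f]
  obtain z where grp: "comm_group \<lparr> carrier = Hom C X A, monoid.mult = add, one = z \<rparr>"
    using pre XA unfolding preadditive_def by blast
  interpret G: comm_group "\<lparr> carrier = Hom C X A, monoid.mult = add, one = z \<rparr>" by (rule grp)
  let ?h = "inv\<^bsub>\<lparr> carrier = Hom C X A, monoid.mult = add, one = z \<rparr>\<^esub> h"
  have h': "?h \<in> Hom C X A" "add h ?h = z"
    using G.inv_closed[of h] G.r_inv[of h] h by auto
  have bil: "f \<cdot> add k ?h = add (f \<cdot> k) (f \<cdot> ?h)" if "k \<in> Hom C X A" for k
    using pre XA BO that h'(1) f unfolding preadditive_def by blast
  have zH: "z \<in> Hom C X A" using G.one_closed by simp
  have "zero_arrow C z" using preadditive_group_one[OF pre Z zH grp] by simp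
  moreover have "f \<cdot> add g ?h = f \<cdot> z" using bil[OF g] bil[OF h] eq h'(2) by simp
  ultimately have "zero_arrow C (f \<cdot> add g ?h)" using zero_arrow_postcomp[OF _ zH f] by simp
  moreover have d: "add g ?h \<in> Hom C X A" using G.m_closed[of g ?h] g h'(1) by simp
  ultimately have "add g ?h = z" using ker preadditive_group_one[OF pre Z d grp] by blast
  then have "add g ?h = add h ?h" using h'(2) by simp
  then show "g = h" using G.right_cancel[of ?h g h] g h h'(1) by simp
qed

text \<open>Because \<open>d\<close> kills \<open>n\<close>, it kills \<open>f\<close>, and so
  factors through the cokernel \<open>c\<close>. It therefore kills \<open>m\<close> as well, and
  \<open>m\<close> lifts along the kernel \<open>n\<close> of \<open>d\<close>.\<close>

lemma (in category) image_least:
  assumes im: "is_image C m f" and f: "f \<in> Hom C A B"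
    and n: "is_kernel C n d" "n \<in> Hom C X B" and fac: "factors_through C f n"
  shows "factors_through C m n"
proof -
  obtain c where c: "is_cokernel C c f" and m: "is_kernel C m c"
    using im unfolding is_image_def by blast
  have dc: "Dom C c = B" using c HomD[OF f] unfolding is_cokernel_def by auto
  have dd: "Dom C d = B" using is_kernelD(1)[OF n(1)] HomD(3)[OF n(2)] HomD(3) by metis
  note c = is_cokernelD[OF c, unfolded HomD(2,3)[OF f]] and m = is_kernelD[OF m, unfolded dc]
  note k = is_kernelD[OF n(1), unfolded dd HomD(2)[OF n(2)]]
  obtain u where u: "u \<in> Hom C A X" "n \<cdot> u = f"
    using fac unfolding factors_through_iff[OF f n(2)] by blast
  have "zero_arrow C (d \<cdot> f)"
    using zero_arrow_precomp[OF k(4) u(1) Comp_closed[OF k(1,2)]] Comp_assoc[OF u(1) k(1,2)] u(2)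
    by simp
  then obtain v where v: "v \<in> Hom C (Cod C c) (Cod C d)" "v \<cdot> c = d" using c(5)[OF k(2)] by blast
  have "zero_arrow C (d \<cdot> m)"
    using zero_arrow_postcomp[OF m(4) Comp_closed[OF m(1,2)] v(1)] Comp_assoc[OF m(1,2) v(1)] v(2)
    by simp
  then show ?thesis unfolding factors_through_iff[OF m(1) n(2)] using k(5)[OF m(1)] by blast
qed

section \<open>Functor categories\<close>

lemma is_functorI:
  assumes "Fo F \<in> extensional (Obj C)" "Fa F \<in> extensional (Arr C)"
    and "\<And>A. A \<in> Obj C \<Longrightarrow> Fo F A \<in> Obj D"
    and "\<And>A B f. f \<in> Hom C A B \<Longrightarrow> Fa F f \<in> Hom D (Fo F A) (Fo F B)"
    and "\<And>A. A \<in> Obj C \<Longrightarrow> Fa F (Idn C A) = Idn D (Fo F A)"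
    and "\<And>A B E f g. f \<in> Hom C A B \<Longrightarrow> g \<in> Hom C B E \<Longrightarrow>
      Fa F (g \<cdot>\<^bsub>C\<^esub> f) = Fa F g \<cdot>\<^bsub>D\<^esub> Fa F f"
  shows "is_functor C D F"
proof -
  have "Fa F f \<in> Hom D (Fo F (Dom C f)) (Fo F (Cod C f))" if "f \<in> Arr C" for f
    using assms(4)[OF Arr_Hom[OF that]] .
  moreover have "Fa F f \<in> Arr D" if "f \<in> Arr C" for f
    using HomD(1)[OF assms(4)[OF Arr_Hom[OF that]]] .
  moreover have "Fa F (g \<cdot>\<^bsub>C\<^esub> f) = Fa F g \<cdot>\<^bsub>D\<^esub> Fa F f"
    if "f \<in> Arr C" "g \<in> Arr C" "Dom C g = Cod C f" for f g
    using assms(6)[OF Arr_Hom[OF that(1)], of g "Cod C g"] that Arr_Hom[of g C] by simp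
  ultimately show ?thesis
    using assms(1,2,3,5) unfolding is_functor_def PiE_def by auto
qed

lemma is_functorD:
  assumes "is_functor C D F"
  shows "Fo F \<in> extensional (Obj C)" "Fa F \<in> extensional (Arr C)"
    and "A \<in> Obj C \<Longrightarrow> Fo F A \<in> Obj D"
    and "f \<in> Hom C A B \<Longrightarrow> Fa F f \<in> Hom D (Fo F A) (Fo F B)"
    and "A \<in> Obj C \<Longrightarrow> Fa F (Idn C A) = Idn D (Fo F A)"
    and "f \<in> Hom C A B \<Longrightarrow> g \<in> Hom C B E \<Longrightarrow> Fa F (g \<cdot>\<^bsub>C\<^esub> f) = Fa F g \<cdot>\<^bsub>D\<^esub> Fa F f"
  using assms unfolding is_functor_def by (auto simp: Hom_iff PiE_iff)

lemma (in category) is_functor_id: "is_functor C C (id_ftor C)"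
  using Dom_closed Cod_closed Comp_closed HomD(1) Idn_closed
  unfolding id_ftor_def by (intro is_functorI) (auto simp: Hom_iff)

lemma (in category) is_functor_comp:
  assumes F: "is_functor C D F" and G: "is_functor D E G"
  shows "is_functor C E (comp_ftor C G F)"
proof (rule is_functorI)
  fix A B f assume f: "f \<in> Hom C A B"
  show "Fa (comp_ftor C G F) f \<in> Hom E (Fo (comp_ftor C G F) A) (Fo (comp_ftor C G F) B)"
    using is_functorD(4)[OF G is_functorD(4)[OF F f]] f Hom_Obj[OF f] HomD[OF f]
    unfolding comp_ftor_def by simp
next
  fix A B X f g assume f: "f \<in> Hom C A B" and g: "g \<in> Hom C B X"
  show "Fa (comp_ftor C G F) (g \<cdot> f) = Fa (comp_ftor C G F) g \<cdot>\<^bsub>E\<^esub> Fa (comp_ftor C G F) f"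
    using is_functorD(6)[OF G is_functorD(4)[OF F f] is_functorD(4)[OF F g]] is_functorD(6)[OF F f g]
      HomD(1)[OF f] HomD(1)[OF g] HomD(1)[OF Comp_closed[OF f g]]
    unfolding comp_ftor_def by simp
next
  fix A assume A: "A \<in> Obj C"
  show "Fa (comp_ftor C G F) (Idn C A) = Idn E (Fo (comp_ftor C G F) A)"
    using is_functorD(3,5)[OF F A] is_functorD(5)[OF G] A HomD(1)[OF Idn_closed[OF A]]
    unfolding comp_ftor_def by simp
qed (use is_functorD(3)[OF G] is_functorD(3)[OF F] in \<open>auto simp: comp_ftor_def\<close>)

section \<open>Natural transformations and the category they form\<close>

lemma Fun_simps:
  "Obj (Fun C D) = {F. is_functor C D F}" "Arr (Fun C D) = {\<eta>. is_ntrans C D \<eta>}"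
  "Dom (Fun C D) = Src" "Cod (Fun C D) = Trg"
  "Src (\<theta> \<cdot>\<^bsub>Fun C D\<^esub> \<eta>) = Src \<eta>" "Trg (\<theta> \<cdot>\<^bsub>Fun C D\<^esub> \<eta>) = Trg \<theta>"
  "A \<in> Obj C \<Longrightarrow> Cmp (\<theta> \<cdot>\<^bsub>Fun C D\<^esub> \<eta>) A = Cmp \<theta> A \<cdot>\<^bsub>D\<^esub> Cmp \<eta> A"
  "A \<in> Obj C \<Longrightarrow> Cmp (Idn (Fun C D) F) A = Idn D (Fo F A)"
  by (simp_all add: Fun_def)

lemma Hom_FunI:
  assumes "is_functor C D F" "is_functor C D G" "Src \<eta> = F" "Trg \<eta> = G"
    and "Cmp \<eta> \<in> extensional (Obj C)"
    and "\<And>A. A \<in> Obj C \<Longrightarrow> Cmp \<eta> A \<in> Hom D (Fo F A) (Fo G A)"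
    and "\<And>A B f. f \<in> Hom C A B \<Longrightarrow> Fa G f \<cdot>\<^bsub>D\<^esub> Cmp \<eta> A = Cmp \<eta> B \<cdot>\<^bsub>D\<^esub> Fa F f"
  shows "\<eta> \<in> Hom (Fun C D) F G"
  using assms(1-6) assms(7)[OF Arr_Hom] by (simp add: Hom_iff Fun_simps is_ntrans_def)

lemma Hom_FunD:
  assumes "\<eta> \<in> Hom (Fun C D) F G"
  shows "is_functor C D F" "is_functor C D G" "Src \<eta> = F" "Trg \<eta> = G"
    and "Cmp \<eta> \<in> extensional (Obj C)"
    and "A \<in> Obj C \<Longrightarrow> Cmp \<eta> A \<in> Hom D (Fo F A) (Fo G A)"
    and "f \<in> Hom C A B \<Longrightarrow> Fa G f \<cdot>\<^bsub>D\<^esub> Cmp \<eta> A = Cmp \<eta> B \<cdot>\<^bsub>D\<^esub> Fa F f"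
  using assms by (auto simp: Hom_iff Fun_simps is_ntrans_def)

lemma Hom_Fun_eqI:
  assumes "\<eta> \<in> Hom (Fun C D) F G" "\<theta> \<in> Hom (Fun C D) F G"
    and "\<And>A. A \<in> Obj C \<Longrightarrow> Cmp \<eta> A = Cmp \<theta> A"
  shows "\<eta> = \<theta>"
  using extensionalityI[OF Hom_FunD(5)[OF assms(1)] Hom_FunD(5)[OF assms(2)]] assms(3)
    Hom_FunD(3,4)[OF assms(1)] Hom_FunD(3,4)[OF assms(2)]
  by (intro ntrans.equality) auto

text \<open>Used twice: at a zero object it is the zero functor, and on a discrete index category it
  is the diagram whose colimit is a copower.\<close>

definition const_ftor :: "('o1, 'm1) precategory \<Rightarrow> ('o2, 'm2) precategory \<Rightarrow> 'o2 \<Rightarrow>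
    ('o1, 'm1, 'o2, 'm2) ftor" where
  "const_ftor C D Z = \<lparr> Fo = restrict (\<lambda>A. Z) (Obj C), Fa = restrict (\<lambda>f. Idn D Z) (Arr C) \<rparr>"

locale functor_category = S: category C + T: category D
  for C :: "('o1, 'm1) precategory" and D :: "('o2, 'm2) precategory"
begin

lemma Fun_comp_closed:
  assumes e: "\<eta> \<in> Hom (Fun C D) F G" and t: "\<theta> \<in> Hom (Fun C D) G H"
  shows "\<theta> \<cdot>\<^bsub>Fun C D\<^esub> \<eta> \<in> Hom (Fun C D) F H"
proof (rule Hom_FunI)
  show "Cmp (\<theta> \<cdot>\<^bsub>Fun C D\<^esub> \<eta>) \<in> extensional (Obj C)" by (simp add: Fun_def)
  show "Cmp (\<theta> \<cdot>\<^bsub>Fun C D\<^esub> \<eta>) A \<in> Hom D (Fo F A) (Fo H A)" if "A \<in> Obj C" for A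
    using T.Comp_closed[OF Hom_FunD(6)[OF e that] Hom_FunD(6)[OF t that]] that
    by (simp add: Fun_simps)
  fix A B f assume f: "f \<in> Hom C A B"
  note o = S.Hom_Obj[OF f]
  note e' = Hom_FunD(6)[OF e o(1)] Hom_FunD(6)[OF e o(2)]
    and t' = Hom_FunD(6)[OF t o(1)] Hom_FunD(6)[OF t o(2)]
  have "Fa H f \<cdot>\<^bsub>D\<^esub> (Cmp \<theta> A \<cdot>\<^bsub>D\<^esub> Cmp \<eta> A) = (Cmp \<theta> B \<cdot>\<^bsub>D\<^esub> Fa G f) \<cdot>\<^bsub>D\<^esub> Cmp \<eta> A"
    using T.Comp_assoc[OF e'(1) t'(1) is_functorD(4)[OF Hom_FunD(2)[OF t] f]] Hom_FunD(7)[OF t f]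
    by simp
  also have "\<dots> = Cmp \<theta> B \<cdot>\<^bsub>D\<^esub> (Cmp \<eta> B \<cdot>\<^bsub>D\<^esub> Fa F f)"
    using T.Comp_assoc[OF e'(1) is_functorD(4)[OF Hom_FunD(2)[OF e] f] t'(2)] Hom_FunD(7)[OF e f]
    by simp
  also have "\<dots> = (Cmp \<theta> B \<cdot>\<^bsub>D\<^esub> Cmp \<eta> B) \<cdot>\<^bsub>D\<^esub> Fa F f"
    using T.Comp_assoc[OF is_functorD(4)[OF Hom_FunD(1)[OF e] f] e'(2) t'(2)] by simp
  finally show "Fa H f \<cdot>\<^bsub>D\<^esub> Cmp (\<theta> \<cdot>\<^bsub>Fun C D\<^esub> \<eta>) A = Cmp (\<theta> \<cdot>\<^bsub>Fun C D\<^esub> \<eta>) B \<cdot>\<^bsub>D\<^esub> Fa F f"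
    using o by (simp add: Fun_simps)
qed (use Hom_FunD[OF e] Hom_FunD[OF t] in \<open>simp_all add: Fun_simps\<close>)

lemma Fun_Idn_closed:
  assumes F: "is_functor C D F"
  shows "Idn (Fun C D) F \<in> Hom (Fun C D) F F"
proof (rule Hom_FunI)
  fix A B f assume f: "f \<in> Hom C A B"
  show "Fa F f \<cdot>\<^bsub>D\<^esub> Cmp (Idn (Fun C D) F) A = Cmp (Idn (Fun C D) F) B \<cdot>\<^bsub>D\<^esub> Fa F f"
    using T.Idn_Comp T.Comp_Idn is_functorD(4)[OF F f] S.Hom_Obj[OF f] by (simp add: Fun_simps)
qed (use F T.Idn_closed is_functorD(3)[OF F] in \<open>auto simp: Fun_def\<close>)

sublocale Fun: category "Fun C D"
proof
  fix F G H K \<eta> \<theta> \<zeta>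
  show "\<theta> \<cdot>\<^bsub>Fun C D\<^esub> \<eta> \<in> Hom (Fun C D) F H"
    if "\<eta> \<in> Hom (Fun C D) F G" "\<theta> \<in> Hom (Fun C D) G H"
    using Fun_comp_closed that .
  show "\<eta> \<cdot>\<^bsub>Fun C D\<^esub> Idn (Fun C D) F = \<eta>" if e: "\<eta> \<in> Hom (Fun C D) F G"
    using T.Comp_Idn Hom_FunD[OF e]
    by (intro Hom_Fun_eqI[OF Fun_comp_closed[OF Fun_Idn_closed e] e]) (auto simp: Fun_simps)
  show "Idn (Fun C D) G \<cdot>\<^bsub>Fun C D\<^esub> \<eta> = \<eta>" if e: "\<eta> \<in> Hom (Fun C D) F G"
    using T.Idn_Comp Hom_FunD[OF e]
    by (intro Hom_Fun_eqI[OF Fun_comp_closed[OF e Fun_Idn_closed] e]) (auto simp: Fun_simps)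
  show "(\<zeta> \<cdot>\<^bsub>Fun C D\<^esub> \<theta>) \<cdot>\<^bsub>Fun C D\<^esub> \<eta> = \<zeta> \<cdot>\<^bsub>Fun C D\<^esub> (\<theta> \<cdot>\<^bsub>Fun C D\<^esub> \<eta>)"
    if e: "\<eta> \<in> Hom (Fun C D) F G" and t: "\<theta> \<in> Hom (Fun C D) G H" and z: "\<zeta> \<in> Hom (Fun C D) H K"
  proof (rule Hom_Fun_eqI)
    show "(\<zeta> \<cdot>\<^bsub>Fun C D\<^esub> \<theta>) \<cdot>\<^bsub>Fun C D\<^esub> \<eta> \<in> Hom (Fun C D) F K"
      using Fun_comp_closed e t z by blast
    show "\<zeta> \<cdot>\<^bsub>Fun C D\<^esub> (\<theta> \<cdot>\<^bsub>Fun C D\<^esub> \<eta>) \<in> Hom (Fun C D) F K"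
      using Fun_comp_closed e t z by blast
    fix A assume "A \<in> Obj C"
    then show "Cmp ((\<zeta> \<cdot>\<^bsub>Fun C D\<^esub> \<theta>) \<cdot>\<^bsub>Fun C D\<^esub> \<eta>) A = Cmp (\<zeta> \<cdot>\<^bsub>Fun C D\<^esub> (\<theta> \<cdot>\<^bsub>Fun C D\<^esub> \<eta>)) A"
      using T.Comp_assoc[OF Hom_FunD(6)[OF e] Hom_FunD(6)[OF t] Hom_FunD(6)[OF z]]
      by (simp add: Fun_simps)
  qed
qed (auto simp: Fun_simps is_ntrans_def intro: Fun_Idn_closed)

section \<open>Objectwise monomorphisms and epimorphisms of functors\<close>

lemma mono_FunI:
  assumes m: "\<mu> \<in> Hom (Fun C D) F G" and "\<And>A. A \<in> Obj C \<Longrightarrow> is_mono D (Cmp \<mu> A)"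
  shows "is_mono (Fun C D) \<mu>"
  unfolding Fun.is_mono_iff[OF m]
proof (intro allI ballI impI)
  fix X \<eta> \<theta> assume e: "\<eta> \<in> Hom (Fun C D) X F" and t: "\<theta> \<in> Hom (Fun C D) X F"
    and eq: "\<mu> \<cdot>\<^bsub>Fun C D\<^esub> \<eta> = \<mu> \<cdot>\<^bsub>Fun C D\<^esub> \<theta>"
  show "\<eta> = \<theta>"
  proof (rule Hom_Fun_eqI[OF e t])
    fix A assume A: "A \<in> Obj C"
    have "Cmp \<mu> A \<cdot>\<^bsub>D\<^esub> Cmp \<eta> A = Cmp \<mu> A \<cdot>\<^bsub>D\<^esub> Cmp \<theta> A"
      using arg_cong[OF eq, of "\<lambda>\<zeta>. Cmp \<zeta> A"] A by (simp add: Fun_simps)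
    then show "Cmp \<eta> A = Cmp \<theta> A"
      using T.mono_cancel[OF assms(2) Hom_FunD(6)[OF m] Hom_FunD(6)[OF e] Hom_FunD(6)[OF t]] A
      by blast
  qed
qed

lemma epi_FunI:
  assumes m: "\<epsilon> \<in> Hom (Fun C D) F G" and "\<And>A. A \<in> Obj C \<Longrightarrow> is_epi D (Cmp \<epsilon> A)"
  shows "is_epi (Fun C D) \<epsilon>"
  unfolding Fun.is_epi_iff[OF m]
proof (intro allI ballI impI)
  fix X \<eta> \<theta> assume e: "\<eta> \<in> Hom (Fun C D) G X" and t: "\<theta> \<in> Hom (Fun C D) G X"
    and eq: "\<eta> \<cdot>\<^bsub>Fun C D\<^esub> \<epsilon> = \<theta> \<cdot>\<^bsub>Fun C D\<^esub> \<epsilon>"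
  show "\<eta> = \<theta>"
  proof (rule Hom_Fun_eqI[OF e t])
    fix A assume A: "A \<in> Obj C"
    have "Cmp \<eta> A \<cdot>\<^bsub>D\<^esub> Cmp \<epsilon> A = Cmp \<theta> A \<cdot>\<^bsub>D\<^esub> Cmp \<epsilon> A"
      using arg_cong[OF eq, of "\<lambda>\<zeta>. Cmp \<zeta> A"] A by (simp add: Fun_simps)
    then show "Cmp \<eta> A = Cmp \<theta> A"
      using T.epi_cancel[OF assms(2) Hom_FunD(6)[OF m] Hom_FunD(6)[OF e] Hom_FunD(6)[OF t]] A
      by blast
  qed
qed

text \<open>Naturality of the objectwise lifts comes for free: the two sides of each square agree
  after composition with the monomorphism \<open>Cmp \<mu> B\<close>, by naturality of
  \<open>\<mu>\<close> and \<open>\<eta>\<close>.\<close>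

lemma Fun_lift_along_mono:
  assumes m: "\<mu> \<in> Hom (Fun C D) F G" and mono: "\<And>A. A \<in> Obj C \<Longrightarrow> is_mono D (Cmp \<mu> A)"
    and e: "\<eta> \<in> Hom (Fun C D) H G"
    and fac: "\<And>A. A \<in> Obj C \<Longrightarrow> \<exists>u\<in>Hom D (Fo H A) (Fo F A). Cmp \<mu> A \<cdot>\<^bsub>D\<^esub> u = Cmp \<eta> A"
  shows "\<exists>\<theta>\<in>Hom (Fun C D) H F. \<mu> \<cdot>\<^bsub>Fun C D\<^esub> \<theta> = \<eta>"
proof -
  obtain u where u: "\<And>A. A \<in> Obj C \<Longrightarrow> u A \<in> Hom D (Fo H A) (Fo F A)"
    "\<And>A. A \<in> Obj C \<Longrightarrow> Cmp \<mu> A \<cdot>\<^bsub>D\<^esub> u A = Cmp \<eta> A"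
    using fac by metis
  define \<theta> where "\<theta> = \<lparr> Src = H, Trg = F, Cmp = restrict u (Obj C) \<rparr>"
  have t: "\<theta> \<in> Hom (Fun C D) H F"
  proof (rule Hom_FunI)
    fix A B f assume f: "f \<in> Hom C A B"
    note o = S.Hom_Obj[OF f]
    note Ff = is_functorD(4)[OF Hom_FunD(1)[OF m] f] and Gf = is_functorD(4)[OF Hom_FunD(2)[OF m] f]
      and Hf = is_functorD(4)[OF Hom_FunD(1)[OF e] f]
    note mA = Hom_FunD(6)[OF m o(1)] and mB = Hom_FunD(6)[OF m o(2)]
    have "Cmp \<mu> B \<cdot>\<^bsub>D\<^esub> (Fa F f \<cdot>\<^bsub>D\<^esub> u A) = (Fa G f \<cdot>\<^bsub>D\<^esub> Cmp \<mu> A) \<cdot>\<^bsub>D\<^esub> u A"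
      using T.Comp_assoc[OF u(1)[OF o(1)] Ff mB] Hom_FunD(7)[OF m f] by simp
    also have "\<dots> = Cmp \<eta> B \<cdot>\<^bsub>D\<^esub> Fa H f"
      using T.Comp_assoc[OF u(1)[OF o(1)] mA Gf] u(2)[OF o(1)] Hom_FunD(7)[OF e f] by simp
    also have "\<dots> = Cmp \<mu> B \<cdot>\<^bsub>D\<^esub> (u B \<cdot>\<^bsub>D\<^esub> Fa H f)"
      using T.Comp_assoc[OF Hf u(1)[OF o(2)] mB] u(2)[OF o(2)] by simp
    finally have "Fa F f \<cdot>\<^bsub>D\<^esub> u A = u B \<cdot>\<^bsub>D\<^esub> Fa H f"
      using T.mono_cancel[OF mono[OF o(2)] mB] T.Comp_closed[OF u(1)[OF o(1)] Ff]
        T.Comp_closed[OF Hf u(1)[OF o(2)]] by blast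
    then show "Fa F f \<cdot>\<^bsub>D\<^esub> Cmp \<theta> A = Cmp \<theta> B \<cdot>\<^bsub>D\<^esub> Fa H f" using o by (simp add: \<theta>_def)
  qed (use Hom_FunD(1)[OF e] Hom_FunD(1)[OF m] u(1) in \<open>simp_all add: \<theta>_def\<close>)
  moreover have "\<mu> \<cdot>\<^bsub>Fun C D\<^esub> \<theta> = \<eta>"
    using u(2) by (intro Hom_Fun_eqI[OF Fun_comp_closed[OF t m] e]) (simp add: Fun_simps \<theta>_def)
  ultimately show ?thesis by blast
qed

text \<open>Dual to \<open>Fun_lift_along_mono\<close>: the naturality squares are compared after
  precomposition with the epimorphism \<open>Cmp \<epsilon> A\<close>.\<close>

lemma Fun_extend_along_epi:
  assumes m: "\<epsilon> \<in> Hom (Fun C D) F G" and epi: "\<And>A. A \<in> Obj C \<Longrightarrow> is_epi D (Cmp \<epsilon> A)"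
    and e: "\<eta> \<in> Hom (Fun C D) F H"
    and fac: "\<And>A. A \<in> Obj C \<Longrightarrow> \<exists>u\<in>Hom D (Fo G A) (Fo H A). u \<cdot>\<^bsub>D\<^esub> Cmp \<epsilon> A = Cmp \<eta> A"
  shows "\<exists>\<theta>\<in>Hom (Fun C D) G H. \<theta> \<cdot>\<^bsub>Fun C D\<^esub> \<epsilon> = \<eta>"
proof -
  obtain u where u: "\<And>A. A \<in> Obj C \<Longrightarrow> u A \<in> Hom D (Fo G A) (Fo H A)"
    "\<And>A. A \<in> Obj C \<Longrightarrow> u A \<cdot>\<^bsub>D\<^esub> Cmp \<epsilon> A = Cmp \<eta> A"
    using fac by metis
  define \<theta> where "\<theta> = \<lparr> Src = G, Trg = H, Cmp = restrict u (Obj C) \<rparr>"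
  have t: "\<theta> \<in> Hom (Fun C D) G H"
  proof (rule Hom_FunI)
    fix A B f assume f: "f \<in> Hom C A B"
    note o = S.Hom_Obj[OF f]
    note Ff = is_functorD(4)[OF Hom_FunD(1)[OF m] f] and Gf = is_functorD(4)[OF Hom_FunD(2)[OF m] f]
      and Hf = is_functorD(4)[OF Hom_FunD(2)[OF e] f]
    note mA = Hom_FunD(6)[OF m o(1)] and mB = Hom_FunD(6)[OF m o(2)]
    have "(Fa H f \<cdot>\<^bsub>D\<^esub> u A) \<cdot>\<^bsub>D\<^esub> Cmp \<epsilon> A = Cmp \<eta> B \<cdot>\<^bsub>D\<^esub> Fa F f"
      using T.Comp_assoc[OF mA u(1)[OF o(1)] Hf] u(2)[OF o(1)] Hom_FunD(7)[OF e f] by simp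
    also have "\<dots> = u B \<cdot>\<^bsub>D\<^esub> (Cmp \<epsilon> B \<cdot>\<^bsub>D\<^esub> Fa F f)"
      using T.Comp_assoc[OF Ff mB u(1)[OF o(2)]] u(2)[OF o(2)] by simp
    also have "\<dots> = (u B \<cdot>\<^bsub>D\<^esub> Fa G f) \<cdot>\<^bsub>D\<^esub> Cmp \<epsilon> A"
      using T.Comp_assoc[OF mA Gf u(1)[OF o(2)]] Hom_FunD(7)[OF m f] by simp
    finally have "Fa H f \<cdot>\<^bsub>D\<^esub> u A = u B \<cdot>\<^bsub>D\<^esub> Fa G f"
      using T.epi_cancel[OF epi[OF o(1)] mA] T.Comp_closed[OF u(1)[OF o(1)] Hf]
        T.Comp_closed[OF Gf u(1)[OF o(2)]] by blast
    then show "Fa H f \<cdot>\<^bsub>D\<^esub> Cmp \<theta> A = Cmp \<theta> B \<cdot>\<^bsub>D\<^esub> Fa G f" using o by (simp add: \<theta>_def)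
  qed (use Hom_FunD(2)[OF e] Hom_FunD(2)[OF m] u(1) in \<open>simp_all add: \<theta>_def\<close>)
  moreover have "\<theta> \<cdot>\<^bsub>Fun C D\<^esub> \<epsilon> = \<eta>"
    using u(2) by (intro Hom_Fun_eqI[OF Fun_comp_closed[OF m t] e]) (simp add: Fun_simps \<theta>_def)
  ultimately show ?thesis by blast
qed

section \<open>Subfunctors and quotient functors\<close>

text \<open>Subobjects \<open>k A\<close> stable under the arrows of \<open>G\<close> form a
  functor. The restricted arrows are picked by \<open>SOME\<close>, but monicity leaves only one
  candidate, and cancelling \<open>k\<close> yields both functor laws.\<close>

lemma subfunctor_exists:
  assumes G: "is_functor C D G"
    and K: "\<And>A. A \<in> Obj C \<Longrightarrow> k A \<in> Hom D (K A) (Fo G A)"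
    and mono: "\<And>A. A \<in> Obj C \<Longrightarrow> is_mono D (k A)"
    and stable: "\<And>A B f. f \<in> Hom C A B \<Longrightarrow> \<exists>u\<in>Hom D (K A) (K B). k B \<cdot>\<^bsub>D\<^esub> u = Fa G f \<cdot>\<^bsub>D\<^esub> k A"
  shows "\<exists>F. \<exists>\<mu>\<in>Hom (Fun C D) F G. \<forall>A\<in>Obj C. Cmp \<mu> A = k A"
proof -
  define v where "v A B f = (SOME u. u \<in> Hom D (K A) (K B) \<and> k B \<cdot>\<^bsub>D\<^esub> u = Fa G f \<cdot>\<^bsub>D\<^esub> k A)" for A B f
  have v: "v A B f \<in> Hom D (K A) (K B)" "k B \<cdot>\<^bsub>D\<^esub> v A B f = Fa G f \<cdot>\<^bsub>D\<^esub> k A" if "f \<in> Hom C A B" for A B f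
    using someI_ex[OF stable[OF that, unfolded Bex_def]] unfolding v_def by auto
  define F where "F = \<lparr> Fo = restrict K (Obj C),
    Fa = restrict (\<lambda>f. v (Dom C f) (Cod C f) f) (Arr C) \<rparr>"
  have Fo: "Fo F A = K A" if "A \<in> Obj C" for A using that by (simp add: F_def)
  have Fa: "Fa F f = v A B f" if "f \<in> Hom C A B" for A B f using HomD[OF that] by (simp add: F_def)
  have KO: "K A \<in> Obj D" if "A \<in> Obj C" for A using T.Hom_Obj[OF K[OF that]] by blast
  have F: "is_functor C D F"
  proof (rule is_functorI)
    fix A B f assume f: "f \<in> Hom C A B"
    show "Fa F f \<in> Hom D (Fo F A) (Fo F B)"
      using v(1)[OF f] Fa[OF f] Fo S.Hom_Obj[OF f] by simp
  next
    fix A assume A: "A \<in> Obj C"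
    note I = S.Idn_closed[OF A]
    have "k A \<cdot>\<^bsub>D\<^esub> v A A (Idn C A) = k A \<cdot>\<^bsub>D\<^esub> Idn D (K A)"
      using v(2)[OF I] is_functorD(5)[OF G A] T.Comp_Idn[OF K[OF A]] T.Idn_Comp[OF K[OF A]] by simp
    then have "v A A (Idn C A) = Idn D (K A)"
      using T.mono_cancel[OF mono K] v(1)[OF I] T.Idn_closed[OF KO] A by blast
    then show "Fa F (Idn C A) = Idn D (Fo F A)" using Fa[OF I] Fo[OF A] by simp
  next
    fix A B E f g assume f: "f \<in> Hom C A B" and g: "g \<in> Hom C B E"
    note gf = S.Comp_closed[OF f g]
    note o = S.Hom_Obj[OF f] S.Hom_Obj(2)[OF g]
    note Gf = is_functorD(4)[OF G f] and Gg = is_functorD(4)[OF G g]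
    have "k E \<cdot>\<^bsub>D\<^esub> v A E (g \<cdot>\<^bsub>C\<^esub> f) = (Fa G g \<cdot>\<^bsub>D\<^esub> Fa G f) \<cdot>\<^bsub>D\<^esub> k A"
      using v(2)[OF gf] is_functorD(6)[OF G f g] by simp
    also have "\<dots> = Fa G g \<cdot>\<^bsub>D\<^esub> (k B \<cdot>\<^bsub>D\<^esub> v A B f)"
      using T.Comp_assoc[OF K[OF o(1)] Gf Gg] v(2)[OF f] by simp
    also have "\<dots> = (k E \<cdot>\<^bsub>D\<^esub> v B E g) \<cdot>\<^bsub>D\<^esub> v A B f"
      using T.Comp_assoc[OF v(1)[OF f] K[OF o(2)] Gg] v(2)[OF g] by simp
    also have "\<dots> = k E \<cdot>\<^bsub>D\<^esub> (v B E g \<cdot>\<^bsub>D\<^esub> v A B f)"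
      using T.Comp_assoc[OF v(1)[OF f] v(1)[OF g] K[OF o(3)]] by simp
    finally have "v A E (g \<cdot>\<^bsub>C\<^esub> f) = v B E g \<cdot>\<^bsub>D\<^esub> v A B f"
      using T.mono_cancel[OF mono[OF o(3)] K[OF o(3)] v(1)[OF gf] T.Comp_closed[OF v(1)[OF f] v(1)[OF g]]]
      by blast
    then show "Fa F (g \<cdot>\<^bsub>C\<^esub> f) = Fa F g \<cdot>\<^bsub>D\<^esub> Fa F f" using Fa[OF f] Fa[OF g] Fa[OF gf] by simp
  qed (use KO in \<open>auto simp: F_def\<close>)
  define \<mu> where "\<mu> = \<lparr> Src = F, Trg = G, Cmp = restrict k (Obj C) \<rparr>"
  have "\<mu> \<in> Hom (Fun C D) F G"
  proof (rule Hom_FunI[OF F G])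
    fix A B f assume f: "f \<in> Hom C A B"
    show "Fa G f \<cdot>\<^bsub>D\<^esub> Cmp \<mu> A = Cmp \<mu> B \<cdot>\<^bsub>D\<^esub> Fa F f"
      using v(2)[OF f] Fa[OF f] S.Hom_Obj[OF f] by (simp add: \<mu>_def)
  qed (use K Fo in \<open>auto simp: \<mu>_def\<close>)
  then show ?thesis by (intro exI bexI[of _ \<mu>]) (auto simp: \<mu>_def)
qed

text \<open>The dual construction: the induced arrows between quotients are unique because each
  \<open>k A\<close> is epi, so identities and composites are respected.\<close>

lemma quotient_functor_exists:
  assumes G: "is_functor C D G"
    and K: "\<And>A. A \<in> Obj C \<Longrightarrow> k A \<in> Hom D (Fo G A) (K A)"
    and epi: "\<And>A. A \<in> Obj C \<Longrightarrow> is_epi D (k A)"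
    and stable: "\<And>A B f. f \<in> Hom C A B \<Longrightarrow> \<exists>u\<in>Hom D (K A) (K B). u \<cdot>\<^bsub>D\<^esub> k A = k B \<cdot>\<^bsub>D\<^esub> Fa G f"
  shows "\<exists>F. \<exists>\<epsilon>\<in>Hom (Fun C D) G F. \<forall>A\<in>Obj C. Cmp \<epsilon> A = k A"
proof -
  define v where "v A B f = (SOME u. u \<in> Hom D (K A) (K B) \<and> u \<cdot>\<^bsub>D\<^esub> k A = k B \<cdot>\<^bsub>D\<^esub> Fa G f)" for A B f
  have v: "v A B f \<in> Hom D (K A) (K B)" "v A B f \<cdot>\<^bsub>D\<^esub> k A = k B \<cdot>\<^bsub>D\<^esub> Fa G f" if "f \<in> Hom C A B" for A B f
    using someI_ex[OF stable[OF that, unfolded Bex_def]] unfolding v_def by auto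
  define F where "F = \<lparr> Fo = restrict K (Obj C),
    Fa = restrict (\<lambda>f. v (Dom C f) (Cod C f) f) (Arr C) \<rparr>"
  have Fo: "Fo F A = K A" if "A \<in> Obj C" for A using that by (simp add: F_def)
  have Fa: "Fa F f = v A B f" if "f \<in> Hom C A B" for A B f using HomD[OF that] by (simp add: F_def)
  have KO: "K A \<in> Obj D" if "A \<in> Obj C" for A using T.Hom_Obj[OF K[OF that]] by blast
  have F: "is_functor C D F"
  proof (rule is_functorI)
    fix A B f assume f: "f \<in> Hom C A B"
    show "Fa F f \<in> Hom D (Fo F A) (Fo F B)"
      using v(1)[OF f] Fa[OF f] Fo S.Hom_Obj[OF f] by simp
  next
    fix A assume A: "A \<in> Obj C"
    note I = S.Idn_closed[OF A]
    have "v A A (Idn C A) \<cdot>\<^bsub>D\<^esub> k A = Idn D (K A) \<cdot>\<^bsub>D\<^esub> k A"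
      using v(2)[OF I] is_functorD(5)[OF G A] T.Comp_Idn[OF K[OF A]] T.Idn_Comp[OF K[OF A]] by simp
    then have "v A A (Idn C A) = Idn D (K A)"
      using T.epi_cancel[OF epi K] v(1)[OF I] T.Idn_closed[OF KO] A by blast
    then show "Fa F (Idn C A) = Idn D (Fo F A)" using Fa[OF I] Fo[OF A] by simp
  next
    fix A B E f g assume f: "f \<in> Hom C A B" and g: "g \<in> Hom C B E"
    note gf = S.Comp_closed[OF f g]
    note o = S.Hom_Obj[OF f] S.Hom_Obj(2)[OF g]
    note Gf = is_functorD(4)[OF G f] and Gg = is_functorD(4)[OF G g]
    have "v A E (g \<cdot>\<^bsub>C\<^esub> f) \<cdot>\<^bsub>D\<^esub> k A = k E \<cdot>\<^bsub>D\<^esub> (Fa G g \<cdot>\<^bsub>D\<^esub> Fa G f)"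
      using v(2)[OF gf] is_functorD(6)[OF G f g] by simp
    also have "\<dots> = (v B E g \<cdot>\<^bsub>D\<^esub> k B) \<cdot>\<^bsub>D\<^esub> Fa G f"
      using T.Comp_assoc[OF Gf Gg K[OF o(3)]] v(2)[OF g] by simp
    also have "\<dots> = v B E g \<cdot>\<^bsub>D\<^esub> (v A B f \<cdot>\<^bsub>D\<^esub> k A)"
      using T.Comp_assoc[OF Gf K[OF o(2)] v(1)[OF g]] v(2)[OF f] by simp
    also have "\<dots> = (v B E g \<cdot>\<^bsub>D\<^esub> v A B f) \<cdot>\<^bsub>D\<^esub> k A"
      using T.Comp_assoc[OF K[OF o(1)] v(1)[OF f] v(1)[OF g]] by simp
    finally have "v A E (g \<cdot>\<^bsub>C\<^esub> f) = v B E g \<cdot>\<^bsub>D\<^esub> v A B f"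
      using T.epi_cancel[OF epi[OF o(1)] K[OF o(1)] v(1)[OF gf] T.Comp_closed[OF v(1)[OF f] v(1)[OF g]]]
      by blast
    then show "Fa F (g \<cdot>\<^bsub>C\<^esub> f) = Fa F g \<cdot>\<^bsub>D\<^esub> Fa F f" using Fa[OF f] Fa[OF g] Fa[OF gf] by simp
  qed (use KO in \<open>auto simp: F_def\<close>)
  define \<epsilon> where "\<epsilon> = \<lparr> Src = G, Trg = F, Cmp = restrict k (Obj C) \<rparr>"
  have "\<epsilon> \<in> Hom (Fun C D) G F"
  proof (rule Hom_FunI[OF G F])
    fix A B f assume f: "f \<in> Hom C A B"
    show "Fa F f \<cdot>\<^bsub>D\<^esub> Cmp \<epsilon> A = Cmp \<epsilon> B \<cdot>\<^bsub>D\<^esub> Fa G f"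
      using v(2)[OF f] Fa[OF f] S.Hom_Obj[OF f] by (simp add: \<epsilon>_def)
  qed (use K Fo in \<open>auto simp: \<epsilon>_def\<close>)
  then show ?thesis by (intro exI bexI[of _ \<epsilon>]) (auto simp: \<epsilon>_def)
qed

section \<open>Constant functors and zero transformations\<close>

lemma is_functor_const:
  assumes "Z \<in> Obj D"
  shows "is_functor C D (const_ftor C D Z)"
proof (rule is_functorI)
  fix A B f assume f: "f \<in> Hom C A B"
  show "Fa (const_ftor C D Z) f \<in> Hom D (Fo (const_ftor C D Z) A) (Fo (const_ftor C D Z) B)"
    using S.Hom_Obj[OF f] HomD(1)[OF f] T.Idn_closed[OF assms] by (simp add: const_ftor_def)
next
  fix A B E f g assume f: "f \<in> Hom C A B" and g: "g \<in> Hom C B E"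
  show "Fa (const_ftor C D Z) (g \<cdot>\<^bsub>C\<^esub> f) = Fa (const_ftor C D Z) g \<cdot>\<^bsub>D\<^esub> Fa (const_ftor C D Z) f"
    using HomD(1)[OF f] HomD(1)[OF g] HomD(1)[OF S.Comp_closed[OF f g]]
      T.Idn_Comp[OF T.Idn_closed[OF assms]]
    by (simp add: const_ftor_def)
qed (use assms HomD(1)[OF S.Idn_closed] in \<open>auto simp: const_ftor_def\<close>)

lemma zero_object_Fun:
  assumes Z: "zero_object D Z"
  shows "zero_object (Fun C D) (const_ftor C D Z)"
proof -
  let ?Z = "const_ftor C D Z"
  note ZO = T.zero_object_Obj[OF Z]
  have ZF: "is_functor C D ?Z" using is_functor_const[OF ZO] .
  have FoZ: "Fo ?Z A = Z" if "A \<in> Obj C" for A using that by (simp add: const_ftor_def)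
  have "(\<exists>!\<eta>. \<eta> \<in> Hom (Fun C D) F ?Z) \<and> (\<exists>!\<eta>. \<eta> \<in> Hom (Fun C D) ?Z F)"
    if F: "is_functor C D F" for F
  proof -
    note FO = is_functorD(3)[OF F]
    obtain s where s: "\<And>A. A \<in> Obj C \<Longrightarrow> s A \<in> Hom D (Fo F A) Z"
      using T.zero_object_ex(1)[OF Z FO] by metis
    obtain t where t: "\<And>A. A \<in> Obj C \<Longrightarrow> t A \<in> Hom D Z (Fo F A)"
      using T.zero_object_ex(2)[OF Z FO] by metis
    have "\<lparr> Src = F, Trg = ?Z, Cmp = restrict s (Obj C) \<rparr> \<in> Hom (Fun C D) F ?Z"
    proof (rule Hom_FunI[OF F ZF], goal_cases)
      \<comment> \<open>The fifth goal of \<open>Hom_FunI\<close> is naturality; both composites end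
        in the zero object \<open>Z\<close> and therefore agree.\<close>
      case (5 A B f)
      note o = S.Hom_Obj[OF 5]
      show ?case
        using T.zero_object_unique(1)[OF Z T.Comp_closed[OF s is_functorD(4)[OF ZF 5, unfolded FoZ[OF o(1)] FoZ[OF o(2)]]]
          T.Comp_closed[OF is_functorD(4)[OF F 5] s]] o by simp
    qed (use s FoZ in auto)
    moreover have "\<lparr> Src = ?Z, Trg = F, Cmp = restrict t (Obj C) \<rparr> \<in> Hom (Fun C D) ?Z F"
    proof (rule Hom_FunI[OF ZF F], goal_cases)
      \<comment> \<open>Here both composites of the naturality square start at
        \<open>Z\<close>.\<close>
      case (5 A B f)
      note o = S.Hom_Obj[OF 5]
      show ?case
        using T.zero_object_unique(2)[OF Z T.Comp_closed[OF t is_functorD(4)[OF F 5]]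
          T.Comp_closed[OF is_functorD(4)[OF ZF 5, unfolded FoZ[OF o(1)] FoZ[OF o(2)]] t]] o by simp
    qed (use t FoZ in auto)
    moreover have "\<eta> = \<theta>" if "\<eta> \<in> Hom (Fun C D) F ?Z" "\<theta> \<in> Hom (Fun C D) F ?Z" for \<eta> \<theta>
      using Hom_FunD(6)[OF that(1)] Hom_FunD(6)[OF that(2)] FoZ T.zero_object_unique(1)[OF Z]
      by (intro Hom_Fun_eqI[OF that]) fastforce
    moreover have "\<eta> = \<theta>" if "\<eta> \<in> Hom (Fun C D) ?Z F" "\<theta> \<in> Hom (Fun C D) ?Z F" for \<eta> \<theta>
      using Hom_FunD(6)[OF that(1)] Hom_FunD(6)[OF that(2)] FoZ T.zero_object_unique(2)[OF Z]
      by (intro Hom_Fun_eqI[OF that]) fastforce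
    ultimately show ?thesis by blast
  qed
  then show ?thesis using ZF unfolding zero_object_def by (simp add: Fun_simps)
qed

text \<open>A factorisation through the constant functor at \<open>Z\<close> gives one through
  \<open>Z\<close> at each object. Conversely, objectwise factorisations need not be assembled: some
  zero transformation \<open>\<theta>\<close> parallel to \<open>\<eta>\<close> exists, and zero
  arrows are unique, so \<open>\<eta>\<close> and \<open>\<theta>\<close> have the same
  components.\<close>

lemma zero_arrow_Fun_iff:
  assumes Z: "zero_object D Z" and e: "\<eta> \<in> Hom (Fun C D) F G"
  shows "zero_arrow (Fun C D) \<eta> \<longleftrightarrow> (\<forall>A\<in>Obj C. zero_arrow D (Cmp \<eta> A))"
proof -
  note ZF = zero_object_Fun[OF Z]
  have comps: "zero_arrow D (Cmp \<theta> A)"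
    if t: "\<theta> \<in> Hom (Fun C D) F G" and z: "zero_arrow (Fun C D) \<theta>" and A: "A \<in> Obj C" for \<theta> A
  proof -
    have FoZ: "Fo (const_ftor C D Z) A = Z" using A by (simp add: const_ftor_def)
    obtain a b where ab: "a \<in> Hom (Fun C D) F (const_ftor C D Z)"
      "b \<in> Hom (Fun C D) (const_ftor C D Z) G" "\<theta> = b \<cdot>\<^bsub>Fun C D\<^esub> a"
      using z Fun.zero_arrow_iff[OF ZF t] by blast
    have "Cmp \<theta> A = Cmp b A \<cdot>\<^bsub>D\<^esub> Cmp a A" using ab(3) A by (simp add: Fun_simps)
    then show ?thesis
      using T.zero_arrow_iff[OF Z Hom_FunD(6)[OF t A]] Hom_FunD(6)[OF ab(1) A] Hom_FunD(6)[OF ab(2) A] FoZ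
      by auto
  qed
  moreover have "zero_arrow (Fun C D) \<eta>" if z: "\<And>A. A \<in> Obj C \<Longrightarrow> zero_arrow D (Cmp \<eta> A)"
  proof -
    obtain \<theta> where t: "\<theta> \<in> Hom (Fun C D) F G" "zero_arrow (Fun C D) \<theta>"
      using Fun.zero_arrow_exists[OF ZF Fun.Hom_Obj[OF e]] by blast
    have "\<eta> = \<theta>"
      using T.zero_arrow_unique[OF z Hom_FunD(6)[OF e] comps[OF t] Hom_FunD(6)[OF t(1)]]
      by (intro Hom_Fun_eqI[OF e t(1)])
    then show ?thesis using t(2) by simp
  qed
  ultimately show ?thesis using e by blast
qed

end

section \<open>Kernels, cokernels and images of transformations into an abelian category\<close>

locale functor_category_abelian = functor_category C D
  for C :: "('o1, 'm1) precategory" and D :: "('o2, 'm2) precategory" +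
  assumes abelian_target: "abelian D"
begin

lemma zero_object_target: "\<exists>Z. zero_object D Z"
  using abelian_target unfolding abelian_def by blast

text \<open>By naturality \<open>Fa F f\<close> maps the kernel at \<open>A\<close> into the kernel
  at \<open>B\<close>, so the objectwise kernels form a subfunctor. The second conjunct records the
  objectwise description, which \<open>mono_FunD\<close> relies on.\<close>

lemma Fun_kernel_exists:
  assumes e: "\<eta> \<in> Hom (Fun C D) F G"
  shows "\<exists>\<kappa>. is_kernel (Fun C D) \<kappa> \<eta> \<and> (\<forall>A\<in>Obj C. is_kernel D (Cmp \<kappa> A) (Cmp \<eta> A))"
proof -
  obtain Z where Z: "zero_object D Z" using zero_object_target by blast
  note eA = Hom_FunD(6)[OF e]
  have "\<exists>k. is_kernel D k (Cmp \<eta> A)" if "A \<in> Obj C" for A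
    using abelian_target HomD(1)[OF eA[OF that]] unfolding abelian_def by blast
  then obtain k where k: "\<And>A. A \<in> Obj C \<Longrightarrow> is_kernel D (k A) (Cmp \<eta> A)" by metis
  have d: "Dom D (Cmp \<eta> A) = Fo F A" "Cod D (Cmp \<eta> A) = Fo G A" if "A \<in> Obj C" for A
    using HomD[OF eA[OF that]] by auto
  have kA: "k A \<in> Hom D (Dom D (k A)) (Fo F A)" "is_mono D (k A)"
    "zero_arrow D (Cmp \<eta> A \<cdot>\<^bsub>D\<^esub> k A)" if "A \<in> Obj C" for A
    using T.is_kernelD[OF k[OF that]] d[OF that] by auto
  have fac: "\<exists>u\<in>Hom D X (Dom D (k A)). k A \<cdot>\<^bsub>D\<^esub> u = g"
    if "A \<in> Obj C" "g \<in> Hom D X (Fo F A)" "zero_arrow D (Cmp \<eta> A \<cdot>\<^bsub>D\<^esub> g)" for A X g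
    using T.is_kernelD(5)[OF k[OF that(1)]] d[OF that(1)] that by simp
  have "\<exists>u\<in>Hom D (Dom D (k A)) (Dom D (k B)). k B \<cdot>\<^bsub>D\<^esub> u = Fa F f \<cdot>\<^bsub>D\<^esub> k A"
    if f: "f \<in> Hom C A B" for A B f
  proof -
    note o = S.Hom_Obj[OF f]
    note Ff = is_functorD(4)[OF Hom_FunD(1)[OF e] f] and Gf = is_functorD(4)[OF Hom_FunD(2)[OF e] f]
    have "Cmp \<eta> B \<cdot>\<^bsub>D\<^esub> (Fa F f \<cdot>\<^bsub>D\<^esub> k A) = Fa G f \<cdot>\<^bsub>D\<^esub> (Cmp \<eta> A \<cdot>\<^bsub>D\<^esub> k A)"
      using T.Comp_assoc[OF kA(1)[OF o(1)] Ff eA[OF o(2)]] Hom_FunD(7)[OF e f]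
        T.Comp_assoc[OF kA(1)[OF o(1)] eA[OF o(1)] Gf] by simp
    then show ?thesis
      using fac[OF o(2) T.Comp_closed[OF kA(1)[OF o(1)] Ff]]
        T.zero_arrow_postcomp[OF kA(3)[OF o(1)] T.Comp_closed[OF kA(1)[OF o(1)] eA[OF o(1)]] Gf]
      by simp
  qed
  then obtain K \<kappa> where k': "\<kappa> \<in> Hom (Fun C D) K F" "\<And>A. A \<in> Obj C \<Longrightarrow> Cmp \<kappa> A = k A"
    using subfunctor_exists[OF Hom_FunD(1)[OF e] kA(1,2)] by blast
  have mono: "is_mono D (Cmp \<kappa> A)" if "A \<in> Obj C" for A using kA(2) k'(2) that by simp
  have KA: "Dom D (k A) = Fo K A" if "A \<in> Obj C" for A
    using HomD(2)[OF Hom_FunD(6)[OF k'(1) that]] k'(2)[OF that] by simp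
  have "is_kernel (Fun C D) \<kappa> \<eta>"
  proof (rule Fun.is_kernelI[OF e k'(1) mono_FunI[OF k'(1) mono]])
    show "zero_arrow (Fun C D) (\<eta> \<cdot>\<^bsub>Fun C D\<^esub> \<kappa>)"
      using zero_arrow_Fun_iff[OF Z Fun_comp_closed[OF k'(1) e]] kA(3) k'(2) by (simp add: Fun_simps)
    fix X \<theta> assume t: "\<theta> \<in> Hom (Fun C D) X F" and z: "zero_arrow (Fun C D) (\<eta> \<cdot>\<^bsub>Fun C D\<^esub> \<theta>)"
    have "zero_arrow D (Cmp \<eta> A \<cdot>\<^bsub>D\<^esub> Cmp \<theta> A)" if "A \<in> Obj C" for A
      using zero_arrow_Fun_iff[OF Z Fun_comp_closed[OF t e]] z that by (auto simp: Fun_simps)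
    then have "\<exists>u\<in>Hom D (Fo X A) (Fo K A). Cmp \<kappa> A \<cdot>\<^bsub>D\<^esub> u = Cmp \<theta> A" if "A \<in> Obj C" for A
      using fac[OF that Hom_FunD(6)[OF t that]] KA[OF that] k'(2)[OF that] that by simp
    then show "\<exists>u\<in>Hom (Fun C D) X K. \<kappa> \<cdot>\<^bsub>Fun C D\<^esub> u = \<theta>"
      using Fun_lift_along_mono[OF k'(1) mono t] by blast
  qed
  then show ?thesis using k k'(2) by auto
qed

text \<open>Dually, \<open>Fa F f\<close> descends to the objectwise cokernels. Their objectwise
  description is what \<open>mono_Fun_is_kernel\<close> takes from here.\<close>

lemma Fun_cokernel_exists:
  assumes e: "\<eta> \<in> Hom (Fun C D) G F"
  shows "\<exists>\<gamma>. is_cokernel (Fun C D) \<gamma> \<eta> \<and> (\<forall>A\<in>Obj C. is_cokernel D (Cmp \<gamma> A) (Cmp \<eta> A))"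
proof -
  obtain Z where Z: "zero_object D Z" using zero_object_target by blast
  note eA = Hom_FunD(6)[OF e]
  have "\<exists>k. is_cokernel D k (Cmp \<eta> A)" if "A \<in> Obj C" for A
    using abelian_target HomD(1)[OF eA[OF that]] unfolding abelian_def by blast
  then obtain k where k: "\<And>A. A \<in> Obj C \<Longrightarrow> is_cokernel D (k A) (Cmp \<eta> A)" by metis
  have d: "Dom D (Cmp \<eta> A) = Fo G A" "Cod D (Cmp \<eta> A) = Fo F A" if "A \<in> Obj C" for A
    using HomD[OF eA[OF that]] by auto
  have kA: "k A \<in> Hom D (Fo F A) (Cod D (k A))" "is_epi D (k A)"
    "zero_arrow D (k A \<cdot>\<^bsub>D\<^esub> Cmp \<eta> A)" if "A \<in> Obj C" for A
    using T.is_cokernelD[OF k[OF that]] d[OF that] by auto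
  have fac: "\<exists>u\<in>Hom D (Cod D (k A)) X. u \<cdot>\<^bsub>D\<^esub> k A = g"
    if "A \<in> Obj C" "g \<in> Hom D (Fo F A) X" "zero_arrow D (g \<cdot>\<^bsub>D\<^esub> Cmp \<eta> A)" for A X g
    using T.is_cokernelD(5)[OF k[OF that(1)]] d[OF that(1)] that by simp
  have "\<exists>u\<in>Hom D (Cod D (k A)) (Cod D (k B)). u \<cdot>\<^bsub>D\<^esub> k A = k B \<cdot>\<^bsub>D\<^esub> Fa F f"
    if f: "f \<in> Hom C A B" for A B f
  proof -
    note o = S.Hom_Obj[OF f]
    note Ff = is_functorD(4)[OF Hom_FunD(2)[OF e] f] and Gf = is_functorD(4)[OF Hom_FunD(1)[OF e] f]
    have "(k B \<cdot>\<^bsub>D\<^esub> Fa F f) \<cdot>\<^bsub>D\<^esub> Cmp \<eta> A = (k B \<cdot>\<^bsub>D\<^esub> Cmp \<eta> B) \<cdot>\<^bsub>D\<^esub> Fa G f"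
      using T.Comp_assoc[OF eA[OF o(1)] Ff kA(1)[OF o(2)]] Hom_FunD(7)[OF e f]
        T.Comp_assoc[OF Gf eA[OF o(2)] kA(1)[OF o(2)]] by simp
    then show ?thesis
      using fac[OF o(1) T.Comp_closed[OF Ff kA(1)[OF o(2)]]]
        T.zero_arrow_precomp[OF kA(3)[OF o(2)] Gf T.Comp_closed[OF eA[OF o(2)] kA(1)[OF o(2)]]]
      by simp
  qed
  then obtain K \<gamma> where k': "\<gamma> \<in> Hom (Fun C D) F K" "\<And>A. A \<in> Obj C \<Longrightarrow> Cmp \<gamma> A = k A"
    using quotient_functor_exists[OF Hom_FunD(2)[OF e] kA(1,2)] by blast
  have epi: "is_epi D (Cmp \<gamma> A)" if "A \<in> Obj C" for A using kA(2) k'(2) that by simp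
  have KA: "Cod D (k A) = Fo K A" if "A \<in> Obj C" for A
    using HomD(3)[OF Hom_FunD(6)[OF k'(1) that]] k'(2)[OF that] by simp
  have "is_cokernel (Fun C D) \<gamma> \<eta>"
  proof (rule Fun.is_cokernelI[OF e k'(1) epi_FunI[OF k'(1) epi]])
    show "zero_arrow (Fun C D) (\<gamma> \<cdot>\<^bsub>Fun C D\<^esub> \<eta>)"
      using zero_arrow_Fun_iff[OF Z Fun_comp_closed[OF e k'(1)]] kA(3) k'(2) by (simp add: Fun_simps)
    fix X \<theta> assume t: "\<theta> \<in> Hom (Fun C D) F X" and z: "zero_arrow (Fun C D) (\<theta> \<cdot>\<^bsub>Fun C D\<^esub> \<eta>)"
    have "zero_arrow D (Cmp \<theta> A \<cdot>\<^bsub>D\<^esub> Cmp \<eta> A)" if "A \<in> Obj C" for A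
      using zero_arrow_Fun_iff[OF Z Fun_comp_closed[OF e t]] z that by (auto simp: Fun_simps)
    then have "\<exists>u\<in>Hom D (Fo K A) (Fo X A). u \<cdot>\<^bsub>D\<^esub> Cmp \<gamma> A = Cmp \<theta> A" if "A \<in> Obj C" for A
      using fac[OF that Hom_FunD(6)[OF t that]] KA[OF that] k'(2)[OF that] that by simp
    then show "\<exists>u\<in>Hom (Fun C D) K X. u \<cdot>\<^bsub>Fun C D\<^esub> \<gamma> = \<theta>"
      using Fun_extend_along_epi[OF k'(1) epi t] by blast
  qed
  then show ?thesis using k k'(2) by auto
qed

text \<open>A monomorphism of functors has zero kernel, and kernels of functors are computed objectwise.\<close>

lemma mono_FunD:
  assumes m: "\<mu> \<in> Hom (Fun C D) F G" and mono: "is_mono (Fun C D) \<mu>" and A: "A \<in> Obj C"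
  shows "is_mono D (Cmp \<mu> A)"
proof -
  obtain Z where Z: "zero_object D Z" using zero_object_target by blast
  obtain add where pre: "preadditive D add" using abelian_target unfolding abelian_def by blast
  obtain \<kappa> where k: "is_kernel (Fun C D) \<kappa> \<mu>" "is_kernel D (Cmp \<kappa> A) (Cmp \<mu> A)"
    using Fun_kernel_exists[OF m] A by blast
  obtain K where kH: "\<kappa> \<in> Hom (Fun C D) K F"
    using Fun.is_kernelD(1)[OF k(1)] HomD(2)[OF m] by simp
  \<comment> \<open>\<open>\<zeta>\<close> is the zero transformation parallel to
    \<open>\<kappa>\<close>. Both become zero after composition with \<open>\<mu>\<close>, so
    cancelling \<open>\<mu>\<close> shows that the kernel is zero.\<close>
  obtain \<zeta> where z: "\<zeta> \<in> Hom (Fun C D) K F" "zero_arrow (Fun C D) \<zeta>"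
    using Fun.zero_arrow_exists[OF zero_object_Fun[OF Z] Fun.Hom_Obj[OF kH]] by blast
  have "\<mu> \<cdot>\<^bsub>Fun C D\<^esub> \<kappa> = \<mu> \<cdot>\<^bsub>Fun C D\<^esub> \<zeta>"
    using Fun.zero_arrow_unique[OF Fun.is_kernelD(4)[OF k(1)] Fun_comp_closed[OF kH m]
      Fun.zero_arrow_postcomp[OF z(2,1) m] Fun_comp_closed[OF z(1) m]] .
  then have "\<kappa> = \<zeta>" using Fun.mono_cancel[OF mono m kH z(1)] by blast
  then have kz: "zero_arrow D (Cmp \<kappa> A)" using zero_arrow_Fun_iff[OF Z z(1)] z(2) A by blast
  note mA = Hom_FunD(6)[OF m A] and kA = Hom_FunD(6)[OF kH A]
  show ?thesis
  \<comment> \<open>An arrow killed by \<open>Cmp \<mu> A\<close> lifts along the zero arrow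
    \<open>Cmp \<kappa> A\<close>, hence vanishes; the additive structure of \<open>D\<close> turns
    this trivial kernel into monicity.\<close>
  proof (rule T.preadditive_monoI[OF pre Z mA])
    fix X g assume g: "g \<in> Hom D X (Fo F A)" and "zero_arrow D (Cmp \<mu> A \<cdot>\<^bsub>D\<^esub> g)"
    then obtain u where "u \<in> Hom D X (Fo K A)" "Cmp \<kappa> A \<cdot>\<^bsub>D\<^esub> u = g"
      using T.is_kernelD(5)[OF k(2)] HomD(2)[OF mA] HomD(2)[OF kA] by fastforce
    then show "zero_arrow D g" using T.zero_arrow_precomp[OF kz _ kA] by blast
  qed
qed

text \<open>Reduces the order on preradicals to single objects. The components of a monic
  \<open>\<nu>\<close> are monic by \<open>mono_FunD\<close>, so objectwise factorisations are
  automatically natural.\<close>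

lemma factors_through_Fun_iff:
  assumes m: "\<mu> \<in> Hom (Fun C D) F G" and n: "\<nu> \<in> Hom (Fun C D) H G" and mono: "is_mono (Fun C D) \<nu>"
  shows "factors_through (Fun C D) \<mu> \<nu> \<longleftrightarrow>
    (\<forall>A\<in>Obj C. factors_through D (Cmp \<mu> A) (Cmp \<nu> A))"
proof
  assume "factors_through (Fun C D) \<mu> \<nu>"
  then obtain u where u: "u \<in> Hom (Fun C D) F H" "\<nu> \<cdot>\<^bsub>Fun C D\<^esub> u = \<mu>"
    unfolding Fun.factors_through_iff[OF m n] by blast
  show "\<forall>A\<in>Obj C. factors_through D (Cmp \<mu> A) (Cmp \<nu> A)"
  proof
    fix A assume A: "A \<in> Obj C"
    have "Cmp \<nu> A \<cdot>\<^bsub>D\<^esub> Cmp u A = Cmp \<mu> A"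
      using Fun_simps(7)[OF A, of D \<nu> u] u(2) by simp
    then show "factors_through D (Cmp \<mu> A) (Cmp \<nu> A)"
      unfolding T.factors_through_iff[OF Hom_FunD(6)[OF m A] Hom_FunD(6)[OF n A]]
      using Hom_FunD(6)[OF u(1) A] by blast
  qed
next
  assume "\<forall>A\<in>Obj C. factors_through D (Cmp \<mu> A) (Cmp \<nu> A)"
  then show "factors_through (Fun C D) \<mu> \<nu>"
    unfolding Fun.factors_through_iff[OF m n]
    using T.factors_through_iff[OF Hom_FunD(6)[OF m] Hom_FunD(6)[OF n]]
    by (intro Fun_lift_along_mono[OF n mono_FunD[OF n mono] m]) blast+
qed

lemma Fun_image_exists:
  assumes e: "\<eta> \<in> Hom (Fun C D) F G"
  shows "\<exists>\<mu>. is_image (Fun C D) \<mu> \<eta>"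
proof -
  obtain \<gamma> where c: "is_cokernel (Fun C D) \<gamma> \<eta>" using Fun_cokernel_exists[OF e] by blast
  show ?thesis
    using Fun_kernel_exists[OF Fun.is_cokernelD(1)[OF c]] c unfolding is_image_def by blast
qed

text \<open>Supplies the kernel hypothesis of \<open>image_least\<close>. Each component of
  \<open>\<nu>\<close> is a kernel in \<open>D\<close>, hence the kernel of its own cokernel, and
  these cokernels are the components of \<open>\<delta>\<close>.\<close>

lemma mono_Fun_is_kernel:
  assumes n: "\<nu> \<in> Hom (Fun C D) H G" and mono: "is_mono (Fun C D) \<nu>"
  shows "\<exists>\<delta>. is_kernel (Fun C D) \<nu> \<delta>"
proof -
  obtain Z where Z: "zero_object D Z" using zero_object_target by blast
  obtain \<delta> where d: "is_cokernel (Fun C D) \<delta> \<nu>"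
    "\<And>A. A \<in> Obj C \<Longrightarrow> is_cokernel D (Cmp \<delta> A) (Cmp \<nu> A)"
    using Fun_cokernel_exists[OF n] by blast
  obtain Q where dH: "\<delta> \<in> Hom (Fun C D) G Q"
    using Fun.is_cokernelD(1)[OF d(1)] HomD(3)[OF n] by simp
  have ker: "is_kernel D (Cmp \<nu> A) (Cmp \<delta> A)" if A: "A \<in> Obj C" for A
  proof -
    obtain f where "is_kernel D (Cmp \<nu> A) f"
      using abelian_target mono_FunD[OF n mono A] unfolding abelian_def by blast
    then show ?thesis using T.kernel_of_cokernel d(2)[OF A] by blast
  qed
  have "is_kernel (Fun C D) \<nu> \<delta>"
  proof (rule Fun.is_kernelI[OF dH n mono Fun.is_cokernelD(4)[OF d(1)]])
    fix X \<theta> assume t: "\<theta> \<in> Hom (Fun C D) X G" and z: "zero_arrow (Fun C D) (\<delta> \<cdot>\<^bsub>Fun C D\<^esub> \<theta>)"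
    show "\<exists>u\<in>Hom (Fun C D) X H. \<nu> \<cdot>\<^bsub>Fun C D\<^esub> u = \<theta>"
      unfolding Fun.factors_through_iff[OF t n, symmetric] factors_through_Fun_iff[OF t n mono]
    proof
      fix A assume A: "A \<in> Obj C"
      have "zero_arrow D (Cmp \<delta> A \<cdot>\<^bsub>D\<^esub> Cmp \<theta> A)"
        using zero_arrow_Fun_iff[OF Z Fun_comp_closed[OF t dH]] z A by (auto simp: Fun_simps)
      then show "factors_through D (Cmp \<theta> A) (Cmp \<nu> A)"
        unfolding T.factors_through_iff[OF Hom_FunD(6)[OF t A] Hom_FunD(6)[OF n A]]
        using T.is_kernelD(5)[OF ker[OF A]] Hom_FunD(6)[OF t A]
          HomD(2)[OF Hom_FunD(6)[OF dH A]] HomD(2)[OF Hom_FunD(6)[OF n A]] by simp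
    qed
  qed
  then show ?thesis ..
qed

end

section \<open>Copowers and alpha functors\<close>

lemma is_copowerD:
  assumes "is_copower C I N P i"
  shows "P \<in> Obj C" "x \<in> I \<Longrightarrow> i x \<in> Hom C N P"
    and "Q \<in> Obj C \<Longrightarrow> (\<And>x. x \<in> I \<Longrightarrow> j x \<in> Hom C N Q) \<Longrightarrow>
      \<exists>!u. u \<in> Hom C P Q \<and> (\<forall>x\<in>I. u \<cdot>\<^bsub>C\<^esub> i x = j x)"
  using assms unfolding is_copower_def by auto

lemma (in category) copower_eqI:
  assumes P: "is_copower C I N P i" and u: "u \<in> Hom C P Q" and v: "v \<in> Hom C P Q"
    and eq: "\<And>x. x \<in> I \<Longrightarrow> u \<cdot> i x = v \<cdot> i x"
  shows "u = v"
  using is_copowerD(3)[OF P Hom_Obj(2)[OF u], of "\<lambda>x. u \<cdot> i x"]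
    Comp_closed[OF is_copowerD(2)[OF P] u] u v eq
  by (metis (no_types, lifting))

lemma is_copower_copower:
  assumes "\<exists>P i. is_copower C I N P i"
  shows "is_copower C I N (fst (copower C I N)) (snd (copower C I N))"
proof -
  have "\<exists>x. case x of (P, i) \<Rightarrow> is_copower C I N P i" using assms by auto
  from someI_ex[OF this] show ?thesis unfolding copower_def by (simp add: case_prod_unfold)
qed

text \<open>A small copower is the colimit of a constant diagram on a discrete category.\<close>

lemma (in category) copower_exists:
  fixes \<kappa> :: "'k rel" and I :: "'i set"
  assumes \<kappa>: "Card_order \<kappa>" and bi: "bicomplete \<kappa> C" and I: "small \<kappa> I" and N: "N \<in> Obj C"
  shows "\<exists>P i. is_copower C I N P i"
proof -
  \<comment> \<open>\<open>bicomplete\<close> quantifies over index categories on the type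
    \<open>'k\<close> alone, so the small index set has to be injected into that type first.\<close>
  have "|I| \<le>o |Field \<kappa>|"
    using I card_of_Field_ordIso[OF \<kappa>] ordLess_imp_ordLeq ordLeq_ordIso_trans ordIso_symmetric
    unfolding small_def by blast
  then obtain e :: "'i \<Rightarrow> 'k" where e: "inj_on e I" unfolding card_of_ordLeq[symmetric] by blast
  \<comment> \<open>Each element of the image of \<open>I\<close> under \<open>e\<close> serves both
    as an object and as its identity arrow. Composable arrows coincide, so returning
    \<open>f\<close> is the right composition.\<close>
  define J :: "('k, 'k) precategory" where
    "J = \<lparr> Obj = e ` I, Arr = e ` I, Dom = id, Cod = id, Idn = id, Comp = \<lambda>g f. f \<rparr>"
  have HJ: "Hom J x y = {f \<in> e ` I. f = x \<and> f = y}" for x y by (auto simp: J_def Hom_def)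
  have J: "category J" by unfold_locales (auto simp: HJ, auto simp: J_def)
  interpret F: functor_category J C using J category_axioms by (simp add: functor_category_def)
  let ?D = "const_ftor J C N"
  have "|e ` I| <o \<kappa>" using I card_of_image ordLeq_ordLess_trans unfolding small_def by blast
  then have sm: "small \<kappa> (Obj J)" "small \<kappa> (Arr J)" by (simp_all add: small_def J_def)
  obtain P p where P: "is_colimit J C ?D P p"
    using bi J sm F.is_functor_const[OF N] unfolding bicomplete_def by blast
  have Fo: "Fo ?D k = N" if "k \<in> e ` I" for k using that by (auto simp: const_ftor_def J_def)
  \<comment> \<open>Compatibility involves identities only, so a cocone is merely a family of arrows
    out of \<open>N\<close>.\<close>
  have cocone: "is_cocone J C ?D Q q \<longleftrightarrow> Q \<in> Obj C \<and> (\<forall>x\<in>I. q (e x) \<in> Hom C N Q)" for Q q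
    using Comp_Idn Fo unfolding is_cocone_def by (auto simp: J_def const_ftor_def)
  have univ: "is_cocone J C ?D P p"
    "\<And>Q q. is_cocone J C ?D Q q \<Longrightarrow> \<exists>!u. u \<in> Hom C P Q \<and> (\<forall>x\<in>I. u \<cdot> p (e x) = q (e x))"
    using P unfolding is_colimit_def by (auto simp: J_def)
  have "is_copower C I N P (\<lambda>x. p (e x))"
    unfolding is_copower_def
  proof (intro conjI ballI allI impI)
    fix Q j assume Q: "Q \<in> Obj C" and j: "\<forall>x\<in>I. j x \<in> Hom C N Q"
    \<comment> \<open>The family \<open>j\<close> is transported to the index type along the inverse
      of \<open>e\<close>.\<close>
    have "is_cocone J C ?D Q (\<lambda>k. j (inv_into I e k))"
      unfolding cocone using Q j inv_into_f_f[OF e] by auto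
    from univ(2)[OF this] show "\<exists>!u. u \<in> Hom C P Q \<and> (\<forall>x\<in>I. u \<cdot> p (e x) = j x)"
      using inv_into_f_f[OF e] by (simp cong: ball_cong)
  qed (use univ(1) cocone in auto)
  then show ?thesis by blast
qed

lemma (in category) id_ftor_simps:
  "A \<in> Obj C \<Longrightarrow> Fo (id_ftor C) A = A" "f \<in> Hom C A B \<Longrightarrow> Fa (id_ftor C) f = f"
  by (auto simp: id_ftor_def Hom_iff)

text \<open>An actual equality thanks to extensionality of functors. It lets the whiskering of
  \<open>\<tau>\<close> with \<open>S\<close> end in \<open>S\<close> itself, as composition with a
  transformation out of \<open>S\<close> requires.\<close>

lemma (in category) comp_ftor_id:
  assumes "is_functor C C F"
  shows "comp_ftor C (id_ftor C) F = F"
proof (rule ftor.equality)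
  show "Fo (comp_ftor C (id_ftor C) F) = Fo F"
    using is_functorD(1,3)[OF assms]
    by (intro extensionalityI[where A = "Obj C"]) (auto simp: comp_ftor_def id_ftor_def)
  show "Fa (comp_ftor C (id_ftor C) F) = Fa F"
    using is_functorD(2)[OF assms] HomD(1)[OF is_functorD(4)[OF assms Arr_Hom]]
    by (intro extensionalityI[where A = "Arr C"]) (auto simp: comp_ftor_def id_ftor_def)
qed auto

lemma alpha_ftor_Fo: "L \<in> Obj C \<Longrightarrow> Fo (alpha_ftor C N M) L = alpha_obj C N M L"
  by (simp add: alpha_ftor_def)

section \<open>Alpha functors and their transformations to the identity\<close>

context category
begin

context
  fixes N M :: 'o
  assumes cop: "\<forall>L\<in>Obj C. \<exists>P i. is_copower C (Hom C M L) N P (i :: 'm \<Rightarrow> 'm)"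
begin

lemma alpha_copower:
  "L \<in> Obj C \<Longrightarrow> is_copower C (Hom C M L) N (alpha_obj C N M L) (alpha_inj C N M L)"
  unfolding alpha_obj_def alpha_inj_def by (intro is_copower_copower bspec[OF cop])

lemmas alpha_obj_Obj = is_copowerD(1)[OF alpha_copower]
lemmas alpha_inj_Hom = is_copowerD(2)[OF alpha_copower]

text \<open>The universal property, applied to the family sending \<open>f\<close> to the injection
  at \<open>l \<cdot> f\<close>, resolves the \<open>THE\<close> in
  \<open>alpha_ftor\<close>.\<close>

lemma alpha_ftor_Fa:
  assumes l: "l \<in> Hom C L L'"
  shows "Fa (alpha_ftor C N M) l \<in> Hom C (alpha_obj C N M L) (alpha_obj C N M L')"
    and "f \<in> Hom C M L \<Longrightarrow>
      Fa (alpha_ftor C N M) l \<cdot> alpha_inj C N M L f = alpha_inj C N M L' (l \<cdot> f)"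
proof -
  have "alpha_inj C N M L' (l \<cdot> f) \<in> Hom C N (alpha_obj C N M L')" if "f \<in> Hom C M L" for f
    using alpha_inj_Hom[OF Hom_Obj(2)[OF l] Comp_closed[OF that l]] .
  from theI'[OF is_copowerD(3)[OF alpha_copower[OF Hom_Obj(1)[OF l]]
      alpha_obj_Obj[OF Hom_Obj(2)[OF l]] this]]
  show "Fa (alpha_ftor C N M) l \<in> Hom C (alpha_obj C N M L) (alpha_obj C N M L')"
    and "f \<in> Hom C M L \<Longrightarrow>
      Fa (alpha_ftor C N M) l \<cdot> alpha_inj C N M L f = alpha_inj C N M L' (l \<cdot> f)"
    using HomD[OF l] by (auto simp: alpha_ftor_def)
qed

text \<open>Both functor laws compare arrows out of a copower, so they are tested on the injections,
  where \<open>alpha_ftor\<close> merely composes indices.\<close>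

lemma is_functor_alpha: "is_functor C C (alpha_ftor C N M)"
proof (rule is_functorI)
  fix L L' l assume l: "l \<in> Hom C L L'"
  show "Fa (alpha_ftor C N M) l \<in> Hom C (Fo (alpha_ftor C N M) L) (Fo (alpha_ftor C N M) L')"
    using alpha_ftor_Fa(1)[OF l] Hom_Obj[OF l] by (simp add: alpha_ftor_Fo)
next
  fix L assume L: "L \<in> Obj C"
  note I = Idn_closed[OF L]
  have "Fa (alpha_ftor C N M) (Idn C L) = Idn C (alpha_obj C N M L)"
  proof (rule copower_eqI[OF alpha_copower[OF L] alpha_ftor_Fa(1)[OF I] Idn_closed[OF alpha_obj_Obj[OF L]]])
    fix f assume f: "f \<in> Hom C M L"
    show "Fa (alpha_ftor C N M) (Idn C L) \<cdot> alpha_inj C N M L f =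
        Idn C (alpha_obj C N M L) \<cdot> alpha_inj C N M L f"
      using alpha_ftor_Fa(2)[OF I f] Idn_Comp[OF f] Idn_Comp[OF alpha_inj_Hom[OF L f]] by simp
  qed
  then show "Fa (alpha_ftor C N M) (Idn C L) = Idn C (Fo (alpha_ftor C N M) L)"
    using alpha_ftor_Fo[OF L] by simp
next
  fix L L' L'' l k assume l: "l \<in> Hom C L L'" and k: "k \<in> Hom C L' L''"
  note kl = Comp_closed[OF l k] and L = Hom_Obj(1)[OF l]
  note Al = alpha_ftor_Fa(1)[OF l] and Ak = alpha_ftor_Fa(1)[OF k]
  show "Fa (alpha_ftor C N M) (k \<cdot> l) = Fa (alpha_ftor C N M) k \<cdot> Fa (alpha_ftor C N M) l"
  proof (rule copower_eqI[OF alpha_copower[OF L] alpha_ftor_Fa(1)[OF kl] Comp_closed[OF Al Ak]])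
    fix f assume f: "f \<in> Hom C M L"
    show "Fa (alpha_ftor C N M) (k \<cdot> l) \<cdot> alpha_inj C N M L f =
        (Fa (alpha_ftor C N M) k \<cdot> Fa (alpha_ftor C N M) l) \<cdot> alpha_inj C N M L f"
      using alpha_ftor_Fa(2)[OF kl f] alpha_ftor_Fa(2)[OF l f]
        alpha_ftor_Fa(2)[OF k Comp_closed[OF f l]] Comp_assoc[OF f l k]
        Comp_assoc[OF alpha_inj_Hom[OF L f] Al Ak] by simp
  qed
qed (auto simp: alpha_ftor_def alpha_obj_Obj)

lemma alpha_ntrans_Cmp:
  assumes h: "h \<in> Hom C N M" and L: "L \<in> Obj C"
  shows "Cmp (alpha_ntrans C h) L \<in> Hom C (alpha_obj C N M L) L"
    and "f \<in> Hom C M L \<Longrightarrow> Cmp (alpha_ntrans C h) L \<cdot> alpha_inj C N M L f = f \<cdot> h"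
  using theI'[OF is_copowerD(3)[OF alpha_copower[OF L] L Comp_closed[OF h]]] HomD[OF h] L
  by (auto simp: alpha_ntrans_def Let_def)

text \<open>On the summand of \<open>f\<close>, both sides of the naturality square at
  \<open>l\<close> reduce to \<open>l \<cdot> f \<cdot> h\<close>.\<close>

lemma alpha_ntrans_Hom:
  assumes h: "h \<in> Hom C N M"
  shows "alpha_ntrans C h \<in> Hom (Fun C C) (alpha_ftor C N M) (id_ftor C)"
proof (rule Hom_FunI[OF is_functor_alpha is_functor_id])
  show "Src (alpha_ntrans C h) = alpha_ftor C N M" "Trg (alpha_ntrans C h) = id_ftor C"
    "Cmp (alpha_ntrans C h) \<in> extensional (Obj C)"
    using HomD[OF h] by (simp_all add: alpha_ntrans_def Let_def)
  show "Cmp (alpha_ntrans C h) L \<in> Hom C (Fo (alpha_ftor C N M) L) (Fo (id_ftor C) L)"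
    if "L \<in> Obj C" for L
    using alpha_ntrans_Cmp(1)[OF h that] alpha_ftor_Fo[OF that] id_ftor_simps(1)[OF that] by simp
  fix L L' l assume l: "l \<in> Hom C L L'"
  note L = Hom_Obj[OF l]
  note a = alpha_ntrans_Cmp(1)[OF h L(1)] and a' = alpha_ntrans_Cmp(1)[OF h L(2)]
  have "l \<cdot> Cmp (alpha_ntrans C h) L = Cmp (alpha_ntrans C h) L' \<cdot> Fa (alpha_ftor C N M) l"
  proof (rule copower_eqI[OF alpha_copower[OF L(1)] Comp_closed[OF a l] Comp_closed[OF alpha_ftor_Fa(1)[OF l] a']])
    fix f assume f: "f \<in> Hom C M L"
    note i = alpha_inj_Hom[OF L(1) f]
    show "(l \<cdot> Cmp (alpha_ntrans C h) L) \<cdot> alpha_inj C N M L f =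
        (Cmp (alpha_ntrans C h) L' \<cdot> Fa (alpha_ftor C N M) l) \<cdot> alpha_inj C N M L f"
      using Comp_assoc[OF i a l] alpha_ntrans_Cmp(2)[OF h L(1) f] Comp_assoc[OF h f l]
        Comp_assoc[OF i alpha_ftor_Fa(1)[OF l] a'] alpha_ftor_Fa(2)[OF l f]
        alpha_ntrans_Cmp(2)[OF h L(2) Comp_closed[OF f l]] by simp
  qed
  then show "Fa (id_ftor C) l \<cdot> Cmp (alpha_ntrans C h) L =
      Cmp (alpha_ntrans C h) L' \<cdot> Fa (alpha_ftor C N M) l"
    using id_ftor_simps(2)[OF l] by simp
qed

end

end

section \<open>Preradicals\<close>

locale abelian_category = category C for C :: "('o, 'm) precategory" (structure) +
  assumes abelian: "abelian C"

sublocale abelian_category \<subseteq> F: functor_category_abelian C C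
  by unfold_locales (rule abelian)

context abelian_category
begin

abbreviation preradical :: "('o, 'm, 'o, 'm) ntrans \<Rightarrow> bool" where
  "preradical \<tau> \<equiv> \<tau> \<in> monos_into (Fun C C) (id_ftor C)"

abbreviation pr_le :: "('o, 'm, 'o, 'm) ntrans \<Rightarrow> ('o, 'm, 'o, 'm) ntrans \<Rightarrow> bool" (infix \<open>\<preceq>\<close> 50) where
  "\<tau> \<preceq> \<sigma> \<equiv> factors_through (Fun C C) \<tau> \<sigma>"

abbreviation pr_prod :: "('o, 'm, 'o, 'm) ntrans \<Rightarrow> ('o, 'm, 'o, 'm) ntrans \<Rightarrow> ('o, 'm, 'o, 'm) ntrans"
  where "pr_prod \<tau> \<sigma> \<equiv> \<sigma> \<cdot>\<^bsub>Fun C C\<^esub> whisker C \<tau> (Src \<sigma>)"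

lemma preradicalD:
  assumes "preradical \<tau>"
  shows "\<tau> \<in> Hom (Fun C C) (Src \<tau>) (id_ftor C)" "is_mono (Fun C C) \<tau>" "is_functor C C (Src \<tau>)"
    and "A \<in> Obj C \<Longrightarrow> Fo (Src \<tau>) A \<in> Obj C"
    and "A \<in> Obj C \<Longrightarrow> Cmp \<tau> A \<in> Hom C (Fo (Src \<tau>) A) A"
    and "A \<in> Obj C \<Longrightarrow> is_mono C (Cmp \<tau> A)"
    and "f \<in> Hom C A B \<Longrightarrow> Fa (Src \<tau>) f \<in> Hom C (Fo (Src \<tau>) A) (Fo (Src \<tau>) B)"
    and "f \<in> Hom C A B \<Longrightarrow> Cmp \<tau> B \<cdot> Fa (Src \<tau>) f = f \<cdot> Cmp \<tau> A"
proof -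
  show H: "\<tau> \<in> Hom (Fun C C) (Src \<tau>) (id_ftor C)" and m: "is_mono (Fun C C) \<tau>"
    using F.Fun.monos_intoD[OF assms] by (auto simp: Fun_simps)
  show T: "is_functor C C (Src \<tau>)" using Hom_FunD(1)[OF H] .
  show "A \<in> Obj C \<Longrightarrow> Fo (Src \<tau>) A \<in> Obj C" using is_functorD(3)[OF T] .
  show "A \<in> Obj C \<Longrightarrow> Cmp \<tau> A \<in> Hom C (Fo (Src \<tau>) A) A"
    using Hom_FunD(6)[OF H] id_ftor_simps(1) by fastforce
  show "A \<in> Obj C \<Longrightarrow> is_mono C (Cmp \<tau> A)" using F.mono_FunD[OF H m] .
  show "f \<in> Hom C A B \<Longrightarrow> Fa (Src \<tau>) f \<in> Hom C (Fo (Src \<tau>) A) (Fo (Src \<tau>) B)"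
    using is_functorD(4)[OF T] .
  show "f \<in> Hom C A B \<Longrightarrow> Cmp \<tau> B \<cdot> Fa (Src \<tau>) f = f \<cdot> Cmp \<tau> A"
    using Hom_FunD(7)[OF H] id_ftor_simps(2) by metis
qed

lemma pr_le_iff:
  assumes "preradical \<tau>" "preradical \<sigma>"
  shows "\<tau> \<preceq> \<sigma> \<longleftrightarrow>
    (\<forall>A\<in>Obj C. \<exists>u\<in>Hom C (Fo (Src \<tau>) A) (Fo (Src \<sigma>) A). Cmp \<sigma> A \<cdot> u = Cmp \<tau> A)"
  using F.factors_through_Fun_iff[OF preradicalD(1)[OF assms(1)] preradicalD(1,2)[OF assms(2)]]
    factors_through_iff[OF preradicalD(5)[OF assms(1)] preradicalD(5)[OF assms(2)]] by simp

section \<open>Products of preradicals\<close>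

lemma whisker_Hom:
  assumes t: "preradical \<tau>" and S: "is_functor C C S"
  shows "whisker C \<tau> S \<in> Hom (Fun C C) (comp_ftor C (Src \<tau>) S) S"
proof (rule Hom_FunI[OF is_functor_comp[OF S preradicalD(3)[OF t]] S])
  show "Trg (whisker C \<tau> S) = S"
    using Hom_FunD(4)[OF preradicalD(1)[OF t]] comp_ftor_id[OF S] by (simp add: whisker_def)
  show "Cmp (whisker C \<tau> S) A \<in> Hom C (Fo (comp_ftor C (Src \<tau>) S) A) (Fo S A)"
    if "A \<in> Obj C" for A
    using preradicalD(5)[OF t is_functorD(3)[OF S that]] that by (simp add: whisker_def comp_ftor_def)
  show "Fa S f \<cdot> Cmp (whisker C \<tau> S) A = Cmp (whisker C \<tau> S) B \<cdot> Fa (comp_ftor C (Src \<tau>) S) f"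
    if "f \<in> Hom C A B" for A B f
    using preradicalD(8)[OF t is_functorD(4)[OF S that]] Hom_Obj[OF that] HomD(1)[OF that]
    by (simp add: whisker_def comp_ftor_def)
qed (simp_all add: whisker_def)

lemma pr_prod_simps:
  assumes "A \<in> Obj C"
  shows "Cmp (pr_prod \<tau> \<sigma>) A = Cmp \<sigma> A \<cdot> Cmp \<tau> (Fo (Src \<sigma>) A)"
    and "Fo (Src (pr_prod \<tau> \<sigma>)) A = Fo (Src \<tau>) (Fo (Src \<sigma>) A)"
  using assms by (simp_all add: Fun_simps whisker_def comp_ftor_def)

lemma preradical_prod:
  assumes t: "preradical \<tau>" and s: "preradical \<sigma>"
  shows "preradical (pr_prod \<tau> \<sigma>)"
proof -
  have H: "pr_prod \<tau> \<sigma> \<in> Hom (Fun C C) (comp_ftor C (Src \<tau>) (Src \<sigma>)) (id_ftor C)"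
    using F.Fun_comp_closed[OF whisker_Hom[OF t preradicalD(3)[OF s]] preradicalD(1)[OF s]] .
  have "is_mono C (Cmp (pr_prod \<tau> \<sigma>) A)" if A: "A \<in> Obj C" for A
    unfolding pr_prod_simps[OF A] using mono_comp preradicalD(4,5,6)[OF s A] preradicalD(5,6)[OF t] by blast
  then show ?thesis using F.mono_FunI[OF H] HomD(3)[OF H] by (simp add: monos_into_def)
qed

text \<open>Write \<open>T'\<close> for \<open>Src \<tau>'\<close>. If \<open>u\<close> witnesses
  \<open>\<sigma>' \<preceq> \<sigma>\<close> at \<open>A\<close> and \<open>v\<close> witnesses
  \<open>\<tau>' \<preceq> \<tau>\<close> at \<open>Fo (Src \<sigma>) A\<close>, then
  \<open>v\<close> after \<open>T'(u)\<close> is the required arrow, by naturality of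
  \<open>\<tau>'\<close> at \<open>u\<close>.\<close>

lemma pr_prod_mono:
  assumes t: "preradical \<tau>" and s: "preradical \<sigma>" and t': "preradical \<tau>'" and s': "preradical \<sigma>'"
    and le: "\<tau>' \<preceq> \<tau>" "\<sigma>' \<preceq> \<sigma>"
  shows "pr_prod \<tau>' \<sigma>' \<preceq> pr_prod \<tau> \<sigma>"
  unfolding pr_le_iff[OF preradical_prod[OF t' s'] preradical_prod[OF t s]]
proof
  fix A assume A: "A \<in> Obj C"
  note SA = preradicalD(4)[OF s A] and SA' = preradicalD(4)[OF s' A]
  obtain u where u: "u \<in> Hom C (Fo (Src \<sigma>') A) (Fo (Src \<sigma>) A)" "Cmp \<sigma> A \<cdot> u = Cmp \<sigma>' A"
    using le(2) A unfolding pr_le_iff[OF s' s] by blast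
  obtain v where v: "v \<in> Hom C (Fo (Src \<tau>') (Fo (Src \<sigma>) A)) (Fo (Src \<tau>) (Fo (Src \<sigma>) A))"
    "Cmp \<tau> (Fo (Src \<sigma>) A) \<cdot> v = Cmp \<tau>' (Fo (Src \<sigma>) A)"
    using le(1) SA unfolding pr_le_iff[OF t' t] by blast
  let ?w = "Fa (Src \<tau>') u"
  note w = preradicalD(7)[OF t' u(1)]
  note vw = Comp_closed[OF w v(1)]
  note sA = preradicalD(5)[OF s A] and tSA = preradicalD(5)[OF t SA]
    and tSA' = preradicalD(5)[OF t' SA'] and tSA'' = preradicalD(5)[OF t' SA]
  have "(Cmp \<sigma> A \<cdot> Cmp \<tau> (Fo (Src \<sigma>) A)) \<cdot> (v \<cdot> ?w) = Cmp \<sigma> A \<cdot> (Cmp \<tau>' (Fo (Src \<sigma>) A) \<cdot> ?w)"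
    using Comp_assoc[OF vw tSA sA] Comp_assoc[OF w v(1) tSA] v(2) by simp
  also have "\<dots> = Cmp \<sigma>' A \<cdot> Cmp \<tau>' (Fo (Src \<sigma>') A)"
    using preradicalD(8)[OF t' u(1)] Comp_assoc[OF tSA' u(1) sA] u(2) by simp
  finally show "\<exists>u\<in>Hom C (Fo (Src (pr_prod \<tau>' \<sigma>')) A) (Fo (Src (pr_prod \<tau> \<sigma>)) A).
      Cmp (pr_prod \<tau> \<sigma>) A \<cdot> u = Cmp (pr_prod \<tau>' \<sigma>') A"
    using vw unfolding pr_prod_simps[OF A] by blast
qed

text \<open>\<open>pr_mult\<close> is a union over all pairs of representatives. Monotonicity in
  both directions makes every pair contribute the same class, so the union of this nonempty constant
  family is that class.\<close>

lemma pr_mult_eq: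
  assumes t: "preradical \<tau>" and s: "preradical \<sigma>"
  shows "pr_mult C (sub_class (Fun C C) \<tau>) (sub_class (Fun C C) \<sigma>) = sub_class (Fun C C) (pr_prod \<tau> \<sigma>)"
proof -
  have eq: "sub_class (Fun C C) (pr_prod \<tau>' \<sigma>') = sub_class (Fun C C) (pr_prod \<tau> \<sigma>)"
    if "\<tau>' \<in> sub_class (Fun C C) \<tau>" "\<sigma>' \<in> sub_class (Fun C C) \<sigma>" for \<tau>' \<sigma>'
  proof -
    have t': "preradical \<tau>'" "\<tau> \<preceq> \<tau>'" "\<tau>' \<preceq> \<tau>" and s': "preradical \<sigma>'" "\<sigma> \<preceq> \<sigma>'" "\<sigma>' \<preceq> \<sigma>"
      using that unfolding F.Fun.mem_sub_class[OF t] F.Fun.mem_sub_class[OF s] by auto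
    show ?thesis
      unfolding F.Fun.sub_class_eq_iff[OF preradical_prod[OF t'(1) s'(1)] preradical_prod[OF t s]]
      using pr_prod_mono[OF t s t'(1) s'(1) t'(3) s'(3)] pr_prod_mono[OF t'(1) s'(1) t s t'(2) s'(2)]
      by blast
  qed
  have "pr_mult C (sub_class (Fun C C) \<tau>) (sub_class (Fun C C) \<sigma>) =
      (\<Union>\<tau>'\<in>sub_class (Fun C C) \<tau>. \<Union>\<sigma>'\<in>sub_class (Fun C C) \<sigma>. sub_class (Fun C C) (pr_prod \<tau> \<sigma>))"
    unfolding pr_mult_def by (intro SUP_cong refl eq)
  moreover have "sub_class (Fun C C) \<tau> \<noteq> {}" "sub_class (Fun C C) \<sigma> \<noteq> {}"
    using F.Fun.self_mem_sub_class[OF t] F.Fun.self_mem_sub_class[OF s] by blast+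
  ultimately show ?thesis by simp
qed

lemma pr_prod_le:
  assumes t: "preradical \<tau>" and s: "preradical \<sigma>"
  shows "pr_prod \<tau> \<sigma> \<preceq> \<sigma>"
  unfolding pr_le_iff[OF preradical_prod[OF t s] s]
proof
  fix A assume A: "A \<in> Obj C"
  show "\<exists>u\<in>Hom C (Fo (Src (pr_prod \<tau> \<sigma>)) A) (Fo (Src \<sigma>) A). Cmp \<sigma> A \<cdot> u = Cmp (pr_prod \<tau> \<sigma>) A"
    unfolding pr_prod_simps[OF A] using preradicalD(5)[OF t preradicalD(4)[OF s A]] by blast
qed

text \<open>The product always lies below its second factor, so only the opposite inequality is at
  stake.\<close>

lemma pr_idempotent_iff:
  assumes t: "preradical \<tau>"
  shows "pr_idempotent C (sub_class (Fun C C) \<tau>) \<longleftrightarrow> \<tau> \<preceq> pr_prod \<tau> \<tau>"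
  unfolding pr_idempotent_def pr_mult_eq[OF t t]
    F.Fun.sub_class_eq_iff[OF preradical_prod[OF t t] t]
  using pr_prod_le[OF t t] by blast

section \<open>Torsion objects and alpha preradicals\<close>

text \<open>Components of preradicals are monic, so a right inverse alone makes them
  isomorphisms.\<close>

lemma mem_torsion_objects:
  assumes t: "preradical \<tau>" and M: "M \<in> Obj C"
  shows "M \<in> torsion_objects C \<tau> \<longleftrightarrow> (\<exists>u\<in>Hom C M (Fo (Src \<tau>) M). Cmp \<tau> M \<cdot> u = Idn C M)"
  using mono_split_epi_is_iso[OF preradicalD(6,5)[OF t M]] is_iso_iff[OF preradicalD(5)[OF t M]] M
  by (auto simp: torsion_objects_def)

text \<open>The image may be replaced by the transformation itself: the latter factors through its
  image, and the image lies below every kernel it factors through, in particular below the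
  monomorphism \<open>\<sigma>\<close>.\<close>

lemma alpha_image_le_iff:
  assumes cop: "\<forall>L\<in>Obj C. \<exists>P i. is_copower C (Hom C M L) M P (i :: 'm \<Rightarrow> 'm)"
    and M: "M \<in> Obj C" and s: "preradical \<sigma>"
    and im: "is_image (Fun C C) \<mu> (alpha_ntrans C (Idn C M))"
  shows "\<mu> \<preceq> \<sigma> \<longleftrightarrow> M \<in> torsion_objects C \<sigma>"
proof
  let ?a = "alpha_ntrans C (Idn C M)"
  note h = Idn_closed[OF M]
  note aH = alpha_ntrans_Hom[OF cop h] and aC = alpha_ntrans_Cmp[OF cop h]
  note cp = alpha_copower[OF cop] and inj = alpha_inj_Hom[OF cop]
  note Fo = alpha_ftor_Fo
  note mu = F.Fun.image_mono[OF im, unfolded HomD(3)[OF aH]]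
  note mH = preradicalD(1)[OF mu]
  {
    assume "\<mu> \<preceq> \<sigma>"
    then have "?a \<preceq> \<sigma>"
      using F.Fun.factors_through_trans[OF F.Fun.factors_through_image[OF im]]
        HomD(1,3)[OF mH] HomD(1,3)[OF preradicalD(1)[OF s]] by simp
    then obtain w where w: "w \<in> Hom (Fun C C) (alpha_ftor C M M) (Src \<sigma>)"
      "\<sigma> \<cdot>\<^bsub>Fun C C\<^esub> w = ?a"
      unfolding F.Fun.factors_through_iff[OF aH preradicalD(1)[OF s]] by blast
    have wM: "Cmp w M \<in> Hom C (alpha_obj C M M M) (Fo (Src \<sigma>) M)" "Cmp \<sigma> M \<cdot> Cmp w M = Cmp ?a M"
      using Hom_FunD(6)[OF w(1) M] Fo[OF M] Fun_simps(7)[OF M, of C \<sigma> w] w(2) by simp_all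
    note i = inj[OF M h]
    \<comment> \<open>Restricting to the summand indexed by the identity of \<open>M\<close>
      produces a right inverse of \<open>Cmp \<sigma> M\<close>.\<close>
    have "Cmp \<sigma> M \<cdot> (Cmp w M \<cdot> alpha_inj C M M M (Idn C M)) = Idn C M"
      using Comp_assoc[OF i wM(1) preradicalD(5)[OF s M]] wM(2) aC(2)[OF M h] Idn_Comp[OF h] by simp
    then show "M \<in> torsion_objects C \<sigma>"
      using mem_torsion_objects[OF s M] Comp_closed[OF i wM(1)] by blast
  }
  {
    assume "M \<in> torsion_objects C \<sigma>"
    then obtain u where u: "u \<in> Hom C M (Fo (Src \<sigma>) M)" "Cmp \<sigma> M \<cdot> u = Idn C M"
      using mem_torsion_objects[OF s M] by blast
    have "?a \<preceq> \<sigma>"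
      unfolding F.factors_through_Fun_iff[OF aH preradicalD(1,2)[OF s]]
    proof
      fix L assume L: "L \<in> Obj C"
      note sL = preradicalD(5)[OF s L]
      \<comment> \<open>This family is forced by naturality: composing its member at
        \<open>f\<close> with \<open>Cmp \<sigma> L\<close> gives back \<open>f\<close>. The copower
        assembles it into the lift \<open>w\<close>.\<close>
      have "Fa (Src \<sigma>) f \<cdot> u \<in> Hom C M (Fo (Src \<sigma>) L)" if "f \<in> Hom C M L" for f
        using Comp_closed[OF u(1) preradicalD(7)[OF s that]] .
      from is_copowerD(3)[where j = "\<lambda>f. Fa (Src \<sigma>) f \<cdot> u", OF cp[OF L] preradicalD(4)[OF s L] this]
      obtain w where w: "w \<in> Hom C (alpha_obj C M M L) (Fo (Src \<sigma>) L)"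
        "\<And>f. f \<in> Hom C M L \<Longrightarrow> w \<cdot> alpha_inj C M M L f = Fa (Src \<sigma>) f \<cdot> u"
        by auto
      have "Cmp \<sigma> L \<cdot> w = Cmp ?a L"
      proof (rule copower_eqI[OF cp[OF L] Comp_closed[OF w(1) sL] aC(1)[OF L]])
        fix f assume f: "f \<in> Hom C M L"
        have "(Cmp \<sigma> L \<cdot> w) \<cdot> alpha_inj C M M L f = (Cmp \<sigma> L \<cdot> Fa (Src \<sigma>) f) \<cdot> u"
          using Comp_assoc[OF inj[OF L f] w(1) sL] w(2)[OF f]
            Comp_assoc[OF u(1) preradicalD(7)[OF s f] sL] by simp
        also have "\<dots> = f \<cdot> Idn C M"
          using preradicalD(8)[OF s f] Comp_assoc[OF u(1) preradicalD(5)[OF s M] f] u(2) by simp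
        finally show "(Cmp \<sigma> L \<cdot> w) \<cdot> alpha_inj C M M L f = Cmp ?a L \<cdot> alpha_inj C M M L f"
          using aC(2)[OF L f] by simp
      qed
      then show "factors_through C (Cmp ?a L) (Cmp \<sigma> L)"
        using w(1) factors_through_iff[OF aC(1)[OF L] sL] by blast
    qed
    then show "\<mu> \<preceq> \<sigma>"
      using F.mono_Fun_is_kernel[OF preradicalD(1,2)[OF s]]
        F.Fun.image_least[OF im aH _ preradicalD(1)[OF s]] by blast
  }
qed

text \<open>Translates the join from classes to representatives: by
  \<open>alpha_image_le_iff\<close>, the upper bounds are the classes of those
  \<open>\<sigma>\<close> for which all of \<open>X\<close> is torsion.\<close>

lemma is_lub_alpha_iff:
  assumes cop: "\<forall>M\<in>Obj C. \<forall>L\<in>Obj C. \<exists>P i. is_copower C (Hom C M L) M P (i :: 'm \<Rightarrow> 'm)"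
    and X: "X \<subseteq> Obj C" and t: "preradical \<tau>"
  shows "is_lub (Pr C) (sub_class (Fun C C) \<tau>) ((\<lambda>M. alpha_pr C (Idn C M)) ` X) \<longleftrightarrow>
    X \<subseteq> torsion_objects C \<tau> \<and> (\<forall>\<sigma>. preradical \<sigma> \<and> X \<subseteq> torsion_objects C \<sigma> \<longrightarrow> \<tau> \<preceq> \<sigma>)"
proof -
  have car: "carrier (Pr C) = {sub_class (Fun C C) \<sigma> | \<sigma>. preradical \<sigma>}"
    unfolding Pr_def subobject_order_def subobjects_def by auto
  have le: "sub_class (Fun C C) \<rho> \<sqsubseteq>\<^bsub>Pr C\<^esub> sub_class (Fun C C) \<sigma> \<longleftrightarrow> \<rho> \<preceq> \<sigma>"
    if "preradical \<rho>" "preradical \<sigma>" for \<rho> \<sigma>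
    unfolding Pr_def using F.Fun.subobject_order_le_iff[OF that] .
  have alpha: "alpha_pr C (Idn C M) \<in> carrier (Pr C) \<and> (\<forall>\<sigma>. preradical \<sigma> \<longrightarrow>
      (alpha_pr C (Idn C M) \<sqsubseteq>\<^bsub>Pr C\<^esub> sub_class (Fun C C) \<sigma> \<longleftrightarrow> M \<in> torsion_objects C \<sigma>))"
    if "M \<in> X" for M
  proof -
    have M: "M \<in> Obj C" using X that by blast
    note aH = alpha_ntrans_Hom[OF bspec[OF cop M] Idn_closed[OF M]]
    obtain \<mu> where im: "is_image (Fun C C) \<mu> (alpha_ntrans C (Idn C M))"
      using F.Fun_image_exists[OF aH] by blast
    have eq: "alpha_pr C (Idn C M) = sub_class (Fun C C) \<mu>"
      unfolding alpha_pr_def using F.Fun.images_eq_sub_class[OF im] .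
    have mu: "preradical \<mu>" using F.Fun.image_mono[OF im, unfolded HomD(3)[OF aH]] .
    show ?thesis
      unfolding eq car using mu le[OF mu] alpha_image_le_iff[OF bspec[OF cop M] M _ im] by blast
  qed
  \<comment> \<open>\<open>Upper\<close> only tests elements of the carrier, so it matters here that
    every alpha preradical belongs to \<open>Pr C\<close>.\<close>
  have U: "p \<in> Upper (Pr C) ((\<lambda>M. alpha_pr C (Idn C M)) ` X) \<longleftrightarrow>
      p \<in> carrier (Pr C) \<and> (\<forall>M\<in>X. alpha_pr C (Idn C M) \<sqsubseteq>\<^bsub>Pr C\<^esub> p)" for p
    using alpha unfolding Upper_def by auto
  have carI: "sub_class (Fun C C) \<sigma> \<in> carrier (Pr C)" if "preradical \<sigma>" for \<sigma>
    using that unfolding car by blast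
  have Upper: "sub_class (Fun C C) \<sigma> \<in> Upper (Pr C) ((\<lambda>M. alpha_pr C (Idn C M)) ` X) \<longleftrightarrow>
      X \<subseteq> torsion_objects C \<sigma>" if "preradical \<sigma>" for \<sigma>
    using alpha that carI[OF that] unfolding U by blast
  have "(\<forall>p\<in>Upper (Pr C) ((\<lambda>M. alpha_pr C (Idn C M)) ` X). sub_class (Fun C C) \<tau> \<sqsubseteq>\<^bsub>Pr C\<^esub> p) \<longleftrightarrow>
      (\<forall>\<sigma>. preradical \<sigma> \<and> X \<subseteq> torsion_objects C \<sigma> \<longrightarrow> \<tau> \<preceq> \<sigma>)" (is "?L \<longleftrightarrow> ?R")
  proof
    assume ?L
    then show ?R using Upper le[OF t] by blast
  next
    assume R: ?R
    show ?L
    proof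
      fix p assume p: "p \<in> Upper (Pr C) ((\<lambda>M. alpha_pr C (Idn C M)) ` X)"
      then obtain \<sigma> where s: "p = sub_class (Fun C C) \<sigma>" "preradical \<sigma>" unfolding U car by blast
      show "sub_class (Fun C C) \<tau> \<sqsubseteq>\<^bsub>Pr C\<^esub> p"
        using p R Upper[OF s(2)] le[OF t s(2)] s by simp
    qed
  qed
  then show ?thesis unfolding least_def using Upper[OF t] Upper_closed by blast
qed

section \<open>Idempotence and torsion objects\<close>

text \<open>If \<open>u\<close> is a right inverse of \<open>Cmp \<tau> M\<close>, then
  \<open>Fa (Src \<tau>) u \<cdot> u\<close> is one for the product: naturality of
  \<open>\<tau>\<close> at \<open>u\<close> moves \<open>u\<close> to the front, and two
  cancellations remain.\<close>

lemma torsion_objects_subset_prod: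
  assumes t: "preradical \<tau>"
  shows "torsion_objects C \<tau> \<subseteq> torsion_objects C (pr_prod \<tau> \<tau>)"
proof
  fix M assume T: "M \<in> torsion_objects C \<tau>"
  then have M: "M \<in> Obj C" by (simp add: torsion_objects_def)
  note tM = preradicalD(5)[OF t M] and TM = preradicalD(4)[OF t M]
  obtain u where u: "u \<in> Hom C M (Fo (Src \<tau>) M)" "Cmp \<tau> M \<cdot> u = Idn C M"
    using T mem_torsion_objects[OF t M] by blast
  note tTM = preradicalD(5)[OF t TM] and Tu = preradicalD(7)[OF t u(1)]
  have "(Cmp \<tau> M \<cdot> Cmp \<tau> (Fo (Src \<tau>) M)) \<cdot> (Fa (Src \<tau>) u \<cdot> u) =
      Cmp \<tau> M \<cdot> ((Cmp \<tau> (Fo (Src \<tau>) M) \<cdot> Fa (Src \<tau>) u) \<cdot> u)"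
    using Comp_assoc[OF Comp_closed[OF u(1) Tu] tTM tM] Comp_assoc[OF u(1) Tu tTM] by simp
  also have "\<dots> = Cmp \<tau> M \<cdot> (u \<cdot> (Cmp \<tau> M \<cdot> u))"
    using preradicalD(8)[OF t u(1)] Comp_assoc[OF u(1) tM u(1)] by simp
  also have "\<dots> = Idn C M" using u(2) Comp_Idn[OF u(1)] by simp
  finally show "M \<in> torsion_objects C (pr_prod \<tau> \<tau>)"
    unfolding mem_torsion_objects[OF preradical_prod[OF t t] M] pr_prod_simps[OF M]
    using Comp_closed[OF u(1) Tu] by blast
qed

text \<open>The inequality at \<open>A\<close> writes \<open>Cmp \<tau> A\<close> as itself composed
  with an endomorphism of \<open>Fo (Src \<tau>) A\<close>. Cancelling the monomorphism makes this
  endomorphism the identity, so \<open>\<tau>\<close> splits at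
  \<open>Fo (Src \<tau>) A\<close>.\<close>

lemma idempotent_torsion:
  assumes t: "preradical \<tau>" and le: "\<tau> \<preceq> pr_prod \<tau> \<tau>" and A: "A \<in> Obj C"
  shows "Fo (Src \<tau>) A \<in> torsion_objects C \<tau>"
proof -
  note tA = preradicalD(5)[OF t A] and TA = preradicalD(4)[OF t A]
  note tTA = preradicalD(5)[OF t TA]
  obtain u where u: "u \<in> Hom C (Fo (Src \<tau>) A) (Fo (Src \<tau>) (Fo (Src \<tau>) A))"
    "(Cmp \<tau> A \<cdot> Cmp \<tau> (Fo (Src \<tau>) A)) \<cdot> u = Cmp \<tau> A"
    using le A unfolding pr_le_iff[OF t preradical_prod[OF t t]] by (auto simp: pr_prod_simps)
  have "Cmp \<tau> A \<cdot> (Cmp \<tau> (Fo (Src \<tau>) A) \<cdot> u) = Cmp \<tau> A \<cdot> Idn C (Fo (Src \<tau>) A)"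
    using u(2) Comp_assoc[OF u(1) tTA tA] Comp_Idn[OF tA] by simp
  then have "Cmp \<tau> (Fo (Src \<tau>) A) \<cdot> u = Idn C (Fo (Src \<tau>) A)"
    using mono_cancel[OF preradicalD(6)[OF t A] tA Comp_closed[OF u(1) tTA] Idn_closed[OF TA]] by blast
  then show ?thesis using mem_torsion_objects[OF t TA] u(1) by blast
qed

text \<open>The lift of \<open>Cmp \<tau> A\<close> is
  \<open>Fa (Src \<sigma>) (Cmp \<tau> A) \<cdot> u\<close>, where \<open>u\<close> is right inverse
  to \<open>\<sigma>\<close> at \<open>Fo (Src \<tau>) A\<close>; naturality of
  \<open>\<sigma>\<close> at \<open>Cmp \<tau> A\<close> verifies this.\<close>

lemma pr_leI_torsion:
  assumes t: "preradical \<tau>" and s: "preradical \<sigma>"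
    and tors: "\<And>A. A \<in> Obj C \<Longrightarrow> Fo (Src \<tau>) A \<in> torsion_objects C \<sigma>"
  shows "\<tau> \<preceq> \<sigma>"
  unfolding pr_le_iff[OF t s]
proof
  fix A assume A: "A \<in> Obj C"
  note tA = preradicalD(5)[OF t A] and TA = preradicalD(4)[OF t A]
  note sA = preradicalD(5)[OF s A] and sTA = preradicalD(5)[OF s TA] and St = preradicalD(7)[OF s tA]
  obtain u where u: "u \<in> Hom C (Fo (Src \<tau>) A) (Fo (Src \<sigma>) (Fo (Src \<tau>) A))"
    "Cmp \<sigma> (Fo (Src \<tau>) A) \<cdot> u = Idn C (Fo (Src \<tau>) A)"
    using tors[OF A] mem_torsion_objects[OF s TA] by blast
  have "Cmp \<sigma> A \<cdot> (Fa (Src \<sigma>) (Cmp \<tau> A) \<cdot> u) = Cmp \<tau> A \<cdot> (Cmp \<sigma> (Fo (Src \<tau>) A) \<cdot> u)"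
    using Comp_assoc[OF u(1) St sA] preradicalD(8)[OF s tA] Comp_assoc[OF u(1) sTA tA] by simp
  also have "\<dots> = Cmp \<tau> A" using u(2) Comp_Idn[OF tA] by simp
  finally show "\<exists>u\<in>Hom C (Fo (Src \<tau>) A) (Fo (Src \<sigma>) A). Cmp \<sigma> A \<cdot> u = Cmp \<tau> A"
    using Comp_closed[OF u(1) St] by blast
qed

end

theorem proposition7p11:
  fixes C :: "('o, 'm) precategory" and \<kappa> :: "'k rel" and \<tau> :: "('o, 'm, 'o, 'm) ntrans"
  assumes "inaccessible \<kappa>"
    and "abelian C" and "bicomplete \<kappa> C" and "small_homs \<kappa> C" and "locally_small \<kappa> C"
    and "\<tau> \<in> monos_into (Fun C C) (id_ftor C)"
  shows "pr_idempotent C (sub_class (Fun C C) \<tau>) \<longleftrightarrow>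
    is_lub (Pr C) (sub_class (Fun C C) \<tau>)
      ((\<lambda>M. alpha_pr C (Idn C M)) ` torsion_objects C \<tau>)"
proof -
  have "category C" using assms(2) unfolding abelian_def preadditive_def by blast
  then interpret abelian_category C
    using assms(2) by (simp add: abelian_category_def abelian_category_axioms_def)
  note t = assms(6)
  \<comment> \<open>Hom-sets are small, so bicompleteness provides every copower indexed by one of
    them.\<close>
  have cop: "\<forall>M\<in>Obj C. \<forall>L\<in>Obj C. \<exists>P i. is_copower C (Hom C M L) M P (i :: 'm \<Rightarrow> 'm)"
    using assms(1,3,4) copower_exists unfolding inaccessible_def small_homs_def by blast
  have "pr_idempotent C (sub_class (Fun C C) \<tau>) \<longleftrightarrow> \<tau> \<preceq> pr_prod \<tau> \<tau>"
    using pr_idempotent_iff[OF t] .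
  \<comment> \<open>From left to right, the values of \<open>Src \<tau>\<close> are torsion for
    \<open>\<tau>\<close>, hence for \<open>\<sigma>\<close>. From right to left,
    \<open>\<sigma>\<close> is specialised to \<open>pr_prod \<tau> \<tau>\<close>.\<close>
  also have "\<dots> \<longleftrightarrow>
      (\<forall>\<sigma>. preradical \<sigma> \<and> torsion_objects C \<tau> \<subseteq> torsion_objects C \<sigma> \<longrightarrow> \<tau> \<preceq> \<sigma>)"
    using torsion_objects_subset_prod[OF t] preradical_prod[OF t t]
      pr_leI_torsion[OF t] idempotent_torsion[OF t] by blast
  also have "\<dots> \<longleftrightarrow> is_lub (Pr C) (sub_class (Fun C C) \<tau>)
      ((\<lambda>M. alpha_pr C (Idn C M)) ` torsion_objects C \<tau>)"
    using is_lub_alpha_iff[OF cop _ t, of "torsion_objects C \<tau>"]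
    by (simp add: torsion_objects_def)
  finally show ?thesis .
qed

end
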